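(* Let $r\in(2,3)$, let $c_r>0$ be the constant (depending only on $r$) used in the definition of the determining wavenumber $\Lambda_{u,r}$, and let $C_0>0$. There exists a constant $C>0$, depending only on $r$, $c_r$ and $C_0$, such that the following holds. Let $L,\nu,T>0$, let $u$ be a Leray-Hopf solution of the 3D Navier-Stokes equations on $\mathbb{T}^3=[0,L]^3$ with viscosity $\nu$ and zero-mean force, defined on a time interval containing $[t,t+T]$, write $\langle g\rangle:=\frac1T\int_t^{t+T}g(\tau)\,d\tau$, $\Lambda:=\Lambda_{u,r}$, and let $Q=Q(\tau)$ be such that $\Lambda(\tau)=\lambda_{Q(\tau)}$. Let $d\in[0,3]$ (the intermittency dimension) be such that $$\Big\langle\sum_{q\le Q}\lambda_q^{-1+\frac6r+d(1-\frac2r)}\|u_q\|_{L^r}^2\Big\rangle\le C_0\,\lambda_0^{d(1-\frac2r)}\Big\langle\sum_{q\le Q}\lambda_q^2\|u_q\|_{L^2}^2\Big\rangle ,$$ and define Kolmogorov's dissipation wavenumber by $$\kappa_{\mathrm d}:=\Big(\frac{\varepsilon}{\nu^3}\Big)^{\frac1{d+1}},\qquad \varepsilon:=\frac{\nu}{L^d}\langle\|\nabla u\|_{L^2}^2\rangle .$$ Then $$\langle\Lambda\rangle-\lambda_0\le C\,\kappa_{\mathrm d}^{\frac{1+d}{1+d(1-\frac2r)}}\,\lambda_0^{-\frac{2d}{r+d(r-2)}} .$$ In particular, if $d=0$ then $\langle\Lambda\rangle-\lambda_0\le C\kappa_{\mathrm d}$, and if $d=3$ then $\langle\Lambda\rangle-\lambda_0\le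 C\kappa_{\mathrm d}^{2+\delta}\lambda_0^{-1-\delta}$ with $\delta=\frac{6-2r}{2r-3}$.
   Context: Equations: on the torus $\mathbb{T}^3=[0,L]^3$ (periodic), $u_t+(u\cdot\nabla)u-\nu\Delta u+\nabla p=f$, $\nabla\cdot u=0$, with $\nu>0$, $f\in H^{-1}(\mathbb{T}^3)$ a time-independent force of zero mean; all solutions are of zero mean. Leray-Hopf solution on $[0,T]$ (on other intervals by time translation): a function $u\in C_{\mathrm w}([0,T];L^2(\mathbb{T}^3))\cap L^2_{\rm loc}([0,T];H^1(\mathbb{T}^3))$, with $\nabla\cdot u=0$ in the sense of distributions, such that $$(u(t),\varphi(t))+\int_0^t\big[-(u,\partial_t\varphi)+\nu(\nabla u,\nabla\varphi)+(u\cdot\nabla u,\varphi)-(f,\varphi)\big]\,ds=(u(0),\varphi(0))$$ for all $t\in[0,T]$ and all $\varphi\in C^\infty([0,T]\times\mathbb{T}^3)$ with $\nabla\cdot\varphi=0$, and $$\tfrac12\|u(t)\|_{L^2}^2\le\tfrac12\|u(t_0)\|_{L^2}^2+\int_{t_0}^t\big[-\nu\|\nabla u(s)\|_{L^2}^2+(f,u)\big]\,ds$$ for almost all $t_0\in(0,T)$ and all $t\in[t_0,T]$. Littlewood-Paley projections: $\lambda_q:=2^q/L$ for integers $q$, so $\lambda_0=1/L$. Fix once and for all a nonnegative radial $\chi\in C_0^\infty(\mathbb{R}^3)$ with $\chi(\xi)=1$ for $|\xi|\le 3/4$ and $\chi(\xi)=0$ for $|\xi|\ge1$ (constants may depend on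 this fixed $\chi$). Let $\varphi(\xi)=\chi(\xi/2)-\chi(\xi)$, $\varphi_q(\xi)=\varphi(2^{-q}\xi)$ for $q\ge0$, $\varphi_{-1}=\chi$. For $q\ge-1$, $u_q:=\Delta_q u:=\sum_{k\in\mathbb{Z}^3}\widehat u(k)\varphi_q(k)e^{i\frac{2\pi}{L}k\cdot x}$, where $\widehat u(k)$ is the $k$th Fourier coefficient, and $u_{\le q}:=\sum_{p=-1}^q u_p$. Sums over $q\le Q$ run over $-1\le q\le Q$ (all $q\ge-1$ if $Q=\infty$). Determining wavenumber: for $r\in(2,3)$ and a constant $c_r>0$, $$\Lambda_{u,r}(t):=\min\{\lambda_q:\ q\in\mathbb{N},\ \lambda_p^{-1+\frac3r}\|u_p(t)\|_{L^r}<c_r\nu\ \ \forall p>q,\ \text{ and }\ \lambda_q^{-1}\|u_{\le q}(t)\|_{L^\infty}<c_r\nu\},$$ where $\mathbb{N}=\{0,1,2,\dots\}$ and $\min\emptyset=\infty$ (with $Q=\infty$ in that case). *)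

theory Defs
  imports "HOL-Analysis.Analysis"
begin

section \<open>Function spaces on the torus\<close>

text \<open>
  Elements of the Lebesgue and Sobolev spaces on the torus are represented by functions
  \<open>real^3 \<Rightarrow> _\<close> of which only the values on the cell \<open>[0,L]\<^sup>3\<close> matter (up to null sets), so no
  periodicity is imposed on them. Periodicity enters through the test functions, which are
  L-periodic on the whole space.
\<close>

definition torus :: "real \<Rightarrow> (real^3) measure" where
  "torus L = lebesgue_on (cbox 0 (\<chi> i. L))"

definition cell_periodic :: "real \<Rightarrow> (real^3 \<Rightarrow> 'b) \<Rightarrow> bool" where
  "cell_periodic L g \<longleftrightarrow> (\<forall>x i. g (x + axis i L) = g x)"

text \<open>
  Derivatives are taken within \<open>S\<close>; for convex \<open>S\<close> with nonempty interior they are unique, and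
  smoothness on a closed set such as \<open>[0,T] \<times> \<real>\<^sup>3\<close> means smoothness up to the boundary.
\<close>

primrec Ck_on :: "nat \<Rightarrow> 'a set \<Rightarrow> ('a::euclidean_space \<Rightarrow> 'b::real_normed_vector) \<Rightarrow> bool" where
  "Ck_on 0 S g \<longleftrightarrow> continuous_on S g"
| "Ck_on (Suc n) S g \<longleftrightarrow>
     (\<exists>g'. (\<forall>x\<in>S. (g has_derivative g' x) (at x within S)) \<and> (\<forall>v. Ck_on n S (\<lambda>x. g' x v)))"

definition smooth_on :: "'a set \<Rightarrow> ('a::euclidean_space \<Rightarrow> 'b::real_normed_vector) \<Rightarrow> bool" where
  "smooth_on S g \<longleftrightarrow> (\<forall>n. Ck_on n S g)"

definition L2_torus :: "real \<Rightarrow> (real^3 \<Rightarrow> 'b::euclidean_space) set" where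
  "L2_torus L = {v. v \<in> borel_measurable (torus L) \<and> integrable (torus L) (\<lambda>x. (norm (v x))\<^sup>2)}"

definition inner_L2 :: "real \<Rightarrow> (real^3 \<Rightarrow> 'b::euclidean_space) \<Rightarrow> (real^3 \<Rightarrow> 'b) \<Rightarrow> real" where
  "inner_L2 L v w = (LINT x|torus L. v x \<bullet> w x)"

definition Lp_norm :: "real \<Rightarrow> real \<Rightarrow> (real^3 \<Rightarrow> 'b::euclidean_space) \<Rightarrow> real" where
  "Lp_norm L p v = (LINT x|torus L. norm (v x) powr p) powr (1 / p)"

definition Linf_norm :: "real \<Rightarrow> (real^3 \<Rightarrow> 'b::euclidean_space) \<Rightarrow> real" where
  "Linf_norm L v = Inf {M. 0 \<le> M \<and> (AE x in torus L. norm (v x) \<le> M)}"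

text \<open>
  Gradients are matrices with entry \<open>G $ i $ j\<close> the \<open>j\<close>-th partial derivative of the \<open>i\<close>-th
  component, as in \<^const>\<open>jacobian\<close>; the norm and inner product of \<open>real^3^3\<close> are the Frobenius
  ones.
\<close>

definition has_weak_grad :: "real \<Rightarrow> (real^3 \<Rightarrow> real^3) \<Rightarrow> (real^3 \<Rightarrow> real^3^3) \<Rightarrow> bool" where
  "has_weak_grad L v G \<longleftrightarrow> G \<in> L2_torus L \<and>
     (\<forall>\<psi>::real^3 \<Rightarrow> real. smooth_on UNIV \<psi> \<and> cell_periodic L \<psi> \<longrightarrow>
        (\<forall>i j. (LINT x|torus L. v x $ i * frechet_derivative \<psi> (at x) (axis j 1))
             = - (LINT x|torus L. G x $ i $ j * \<psi> x)))"

definition H1_torus :: "real \<Rightarrow> (real^3 \<Rightarrow> real^3) set" where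
  "H1_torus L = {v \<in> L2_torus L. \<exists>G. has_weak_grad L v G}"

text \<open>Meaningful on \<open>H1_torus L\<close> only, where it is unique up to null sets.\<close>

definition weak_grad :: "real \<Rightarrow> (real^3 \<Rightarrow> real^3) \<Rightarrow> real^3 \<Rightarrow> real^3^3" where
  "weak_grad L v = (SOME G. has_weak_grad L v G)"

definition H1_norm :: "real \<Rightarrow> (real^3 \<Rightarrow> real^3) \<Rightarrow> real" where
  "H1_norm L v = sqrt ((Lp_norm L 2 v)\<^sup>2 + (Lp_norm L 2 (weak_grad L v))\<^sup>2)"

text \<open>
  \<open>H\<^sup>-\<^sup>1\<close> is the dual of \<open>H\<^sup>1\<close>, so a force \<open>f\<close> is a bounded linear functional and the pairing
  \<open>(f,v)\<close> is the application \<open>f v\<close>. Zero mean says that \<open>f\<close> annihilates constant fields.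
\<close>

definition Hminus1_torus :: "real \<Rightarrow> ((real^3 \<Rightarrow> real^3) \<Rightarrow> real) set" where
  "Hminus1_torus L = {f.
     (\<forall>v\<in>H1_torus L. \<forall>w\<in>H1_torus L. f (\<lambda>x. v x + w x) = f v + f w) \<and>
     (\<forall>a. \<forall>v\<in>H1_torus L. f (\<lambda>x. a *\<^sub>R v x) = a * f v) \<and>
     (\<exists>K. \<forall>v\<in>H1_torus L. \<bar>f v\<bar> \<le> K * H1_norm L v)}"

definition zero_mean_force :: "((real^3 \<Rightarrow> real^3) \<Rightarrow> real) \<Rightarrow> bool" where
  "zero_mean_force f \<longleftrightarrow> (\<forall>a. f (\<lambda>x. a) = 0)"


section \<open>Leray-Hopf solutions\<close>

definition weakly_continuous_L2 :: "real \<Rightarrow> real \<Rightarrow> (real \<Rightarrow> real^3 \<Rightarrow> real^3) \<Rightarrow> bool" where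
  "weakly_continuous_L2 L T u \<longleftrightarrow>
     (\<forall>s\<in>{0..T}. u s \<in> L2_torus L) \<and>
     (\<forall>w\<in>L2_torus L. continuous_on {0..T} (\<lambda>s. inner_L2 L (u s) w))"

text \<open>
  On the compact interval \<open>[0,T]\<close>, locally square integrable is square integrable. Measurability
  of \<open>u\<close> as an \<open>H\<^sup>1\<close>-valued map is automatic for weakly continuous \<open>u\<close>.
\<close>

definition L2_time_H1 :: "real \<Rightarrow> real \<Rightarrow> (real \<Rightarrow> real^3 \<Rightarrow> real^3) \<Rightarrow> bool" where
  "L2_time_H1 L T u \<longleftrightarrow>
     (AE s in lebesgue_on {0..T}. u s \<in> H1_torus L) \<and>
     integrable (lebesgue_on {0..T}) (\<lambda>s. (H1_norm L (u s))\<^sup>2)"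

definition weakly_div_free :: "real \<Rightarrow> (real^3 \<Rightarrow> real^3) \<Rightarrow> bool" where
  "weakly_div_free L v \<longleftrightarrow>
     (\<forall>\<psi>::real^3 \<Rightarrow> real. smooth_on UNIV \<psi> \<and> cell_periodic L \<psi> \<longrightarrow>
        (LINT x|torus L. frechet_derivative \<psi> (at x) (v x)) = 0)"

definition zero_mean :: "real \<Rightarrow> (real^3 \<Rightarrow> real^3) \<Rightarrow> bool" where
  "zero_mean L v \<longleftrightarrow> (LINT x|torus L. v x) = 0"

definition div_free_test :: "real \<Rightarrow> real \<Rightarrow> (real \<Rightarrow> real^3 \<Rightarrow> real^3) \<Rightarrow> bool" where
  "div_free_test L T \<phi> \<longleftrightarrow>
     smooth_on ({0..T} \<times> UNIV) (\<lambda>(s, x). \<phi> s x) \<and>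
     (\<forall>s\<in>{0..T}. cell_periodic L (\<phi> s) \<and> (\<forall>x. trace (jacobian (\<phi> s) (at x)) = 0))"

definition NS_weak_formulation ::
  "real \<Rightarrow> real \<Rightarrow> ((real^3 \<Rightarrow> real^3) \<Rightarrow> real) \<Rightarrow> real \<Rightarrow> (real \<Rightarrow> real^3 \<Rightarrow> real^3) \<Rightarrow> bool" where
  "NS_weak_formulation L \<nu> f T u \<longleftrightarrow>
     (\<forall>\<phi>. div_free_test L T \<phi> \<longrightarrow> (\<forall>t\<in>{0..T}.
        inner_L2 L (u t) (\<phi> t)
        + (LINT s|lebesgue_on {0..t}.
             - inner_L2 L (u s) (\<lambda>x. vector_derivative (\<lambda>\<sigma>. \<phi> \<sigma> x) (at s within {0..T}))
             + \<nu> * inner_L2 L (weak_grad L (u s)) (\<lambda>x. jacobian (\<phi> s) (at x))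
             + inner_L2 L (\<lambda>x. weak_grad L (u s) x *v u s x) (\<phi> s)
             - f (\<phi> s))
        = inner_L2 L (u 0) (\<phi> 0)))"

definition energy_inequality ::
  "real \<Rightarrow> real \<Rightarrow> ((real^3 \<Rightarrow> real^3) \<Rightarrow> real) \<Rightarrow> real \<Rightarrow> (real \<Rightarrow> real^3 \<Rightarrow> real^3) \<Rightarrow> bool" where
  "energy_inequality L \<nu> f T u \<longleftrightarrow>
     (AE t0 in lebesgue_on {0<..<T}. \<forall>t\<in>{t0..T}.
        1/2 * (Lp_norm L 2 (u t))\<^sup>2
        \<le> 1/2 * (Lp_norm L 2 (u t0))\<^sup>2
          + (LINT s|lebesgue_on {t0..t}. - \<nu> * (Lp_norm L 2 (weak_grad L (u s)))\<^sup>2 + f (u s)))"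

definition leray_hopf ::
  "real \<Rightarrow> real \<Rightarrow> ((real^3 \<Rightarrow> real^3) \<Rightarrow> real) \<Rightarrow> real \<Rightarrow> (real \<Rightarrow> real^3 \<Rightarrow> real^3) \<Rightarrow> bool" where
  "leray_hopf L \<nu> f T u \<longleftrightarrow>
     weakly_continuous_L2 L T u \<and> L2_time_H1 L T u \<and>
     (\<forall>s\<in>{0..T}. weakly_div_free L (u s) \<and> zero_mean L (u s)) \<and>
     NS_weak_formulation L \<nu> f T u \<and> energy_inequality L \<nu> f T u"

definition leray_hopf_on ::
  "real \<Rightarrow> real \<Rightarrow> ((real^3 \<Rightarrow> real^3) \<Rightarrow> real) \<Rightarrow> real \<Rightarrow> real \<Rightarrow> (real \<Rightarrow> real^3 \<Rightarrow> real^3) \<Rightarrow> bool" where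
  "leray_hopf_on L \<nu> f a b u \<longleftrightarrow> leray_hopf L \<nu> f (b - a) (\<lambda>s. u (a + s))"


section \<open>Littlewood-Paley projections and the determining wavenumber\<close>

text \<open>Compact support of the cutoff follows from its vanishing outside the unit ball.\<close>

definition LP_cutoff :: "(real^3 \<Rightarrow> real) \<Rightarrow> bool" where
  "LP_cutoff chi \<longleftrightarrow> smooth_on UNIV chi \<and> (\<forall>\<xi>. 0 \<le> chi \<xi>) \<and>
     (\<forall>\<xi> \<eta>. norm \<xi> = norm \<eta> \<longrightarrow> chi \<xi> = chi \<eta>) \<and>
     (\<forall>\<xi>. norm \<xi> \<le> 3/4 \<longrightarrow> chi \<xi> = 1) \<and> (\<forall>\<xi>. norm \<xi> \<ge> 1 \<longrightarrow> chi \<xi> = 0)"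

definition LP_freq :: "real \<Rightarrow> int \<Rightarrow> real" where
  "LP_freq L q = 2 powi q / L"

definition LP_symbol :: "(real^3 \<Rightarrow> real) \<Rightarrow> int \<Rightarrow> real^3 \<Rightarrow> real" where
  "LP_symbol chi q \<xi> =
     (if q = -1 then chi \<xi>
      else chi ((2 powi (-q) / 2) *\<^sub>R \<xi>) - chi (2 powi (-q) *\<^sub>R \<xi>))"

definition int_vec :: "int^3 \<Rightarrow> real^3" where
  "int_vec k = (\<chi> i. of_int (k $ i))"

definition fourier_coeff :: "real \<Rightarrow> (real^3 \<Rightarrow> real^3) \<Rightarrow> int^3 \<Rightarrow> complex^3" where
  "fourier_coeff L v k =
     (\<chi> i. (LINT x|torus L. complex_of_real (v x $ i) * cis (- (2 * pi / L * (int_vec k \<bullet> x))))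
            / of_real (L ^ 3))"

text \<open>
  The values are real vectors up to the inclusion of \<open>real^3\<close> in \<open>complex^3\<close>, which preserves
  norms. Only finitely many terms of the sum are nonzero.
\<close>

definition LP_proj :: "(real^3 \<Rightarrow> real) \<Rightarrow> real \<Rightarrow> int \<Rightarrow> (real^3 \<Rightarrow> real^3) \<Rightarrow> real^3 \<Rightarrow> complex^3" where
  "LP_proj chi L q v x =
     (\<Sum>\<^sub>\<infinity>k\<in>UNIV. (of_real (LP_symbol chi q (int_vec k)) * cis (2 * pi / L * (int_vec k \<bullet> x)))
                   *s fourier_coeff L v k)"

definition LP_low :: "(real^3 \<Rightarrow> real) \<Rightarrow> real \<Rightarrow> int \<Rightarrow> (real^3 \<Rightarrow> real^3) \<Rightarrow> real^3 \<Rightarrow> complex^3" where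
  "LP_low chi L q v x = (\<Sum>p = -1..q. LP_proj chi L p v x)"

text \<open>
  The infimum is taken over a subset of \<open>{LP_freq L q | q \<in> \<nat>}\<close>, so it is a minimum unless the
  set is empty, in which case it is \<open>\<infinity>\<close>.
\<close>

definition determining_wavenumber ::
  "(real^3 \<Rightarrow> real) \<Rightarrow> real \<Rightarrow> real \<Rightarrow> real \<Rightarrow> real \<Rightarrow> (real^3 \<Rightarrow> real^3) \<Rightarrow> ennreal" where
  "determining_wavenumber chi L \<nu> r c v =
     Inf {ennreal (LP_freq L (int q)) | q::nat.
       (\<forall>p > int q. LP_freq L p powr (-1 + 3 / r) * Lp_norm L r (LP_proj chi L p v) < c * \<nu>) \<and>
       LP_freq L (int q) powr (-1) * Linf_norm L (LP_low chi L (int q) v) < c * \<nu>}"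

definition LP_freq_enat :: "real \<Rightarrow> enat \<Rightarrow> ennreal" where
  "LP_freq_enat L Q = (case Q of enat n \<Rightarrow> ennreal (LP_freq L (int n)) | \<infinity> \<Rightarrow> \<infinity>)"

definition LP_range :: "enat \<Rightarrow> int set" where
  "LP_range Q = (case Q of enat n \<Rightarrow> {-1..int n} | \<infinity> \<Rightarrow> {-1..})"


section \<open>Time averages and Kolmogorov's dissipation wavenumber\<close>

definition time_avg :: "real \<Rightarrow> real \<Rightarrow> (real \<Rightarrow> ennreal) \<Rightarrow> ennreal" where
  "time_avg t T g = ennreal (1 / T) * (\<integral>\<^sup>+\<tau>. g \<tau> \<partial>lebesgue_on {t..t + T})"

definition dissipation_rate ::
  "real \<Rightarrow> real \<Rightarrow> real \<Rightarrow> real \<Rightarrow> real \<Rightarrow> (real \<Rightarrow> real^3 \<Rightarrow> real^3) \<Rightarrow> real" where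
  "dissipation_rate L \<nu> d t T u =
     \<nu> / L powr d * (1 / T * (LINT \<tau>|lebesgue_on {t..t + T}. (Lp_norm L 2 (weak_grad L (u \<tau>)))\<^sup>2))"

definition kolmogorov_wavenumber ::
  "real \<Rightarrow> real \<Rightarrow> real \<Rightarrow> real \<Rightarrow> real \<Rightarrow> (real \<Rightarrow> real^3 \<Rightarrow> real^3) \<Rightarrow> real" where
  "kolmogorov_wavenumber L \<nu> d t T u = (dissipation_rate L \<nu> d t T u / \<nu> ^ 3) powr (1 / (d + 1))"

text \<open>
  The intermittency condition. Both averages are taken in \<^typ>\<open>ennreal\<close>, as the sums may be
  infinite where the determining wavenumber is.
\<close>

definition intermittency ::
  "(real^3 \<Rightarrow> real) \<Rightarrow> real \<Rightarrow> real \<Rightarrow> real \<Rightarrow> real \<Rightarrow> real \<Rightarrow> real \<Rightarrow> (real \<Rightarrow> enat) \<Rightarrow>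
    (real \<Rightarrow> real^3 \<Rightarrow> real^3) \<Rightarrow> bool" where
  "intermittency chi L r C0 d t T Q u \<longleftrightarrow>
     time_avg t T (\<lambda>\<tau>. \<Sum>\<^sub>\<infinity>q\<in>LP_range (Q \<tau>).
        ennreal (LP_freq L q powr (-1 + 6 / r + d * (1 - 2 / r)) *
                 (Lp_norm L r (LP_proj chi L q (u \<tau>)))\<^sup>2))
     \<le> ennreal (C0 * LP_freq L 0 powr (d * (1 - 2 / r))) *
       time_avg t T (\<lambda>\<tau>. \<Sum>\<^sub>\<infinity>q\<in>LP_range (Q \<tau>).
         ennreal ((LP_freq L q)\<^sup>2 * (Lp_norm L 2 (LP_proj chi L q (u \<tau>)))\<^sup>2))"

end

theory Submission
  imports Defs
begin

text \<open>
  Put \<open>D = d (1 - 2/r)\<close>. If a scale \<open>m\<close> violates the conditions defining the determining wavenumber,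
  then either one shell \<open>p > m\<close> is large in \<open>L\<^sup>r\<close>, or \<open>u\<^bsub>\<le>m\<^esub>\<close> is large in \<open>L\<^sup>\<infinity>\<close>; in the latter case
  Bernstein's inequality and the Cauchy-Schwarz inequality apply, the remaining factor being a
  geometric sum of \<open>\<lambda>\<^sub>p\<close> to the power \<open>1 - D > 0\<close>. Either way \<open>\<nu>\<^sup>2\<close> times the power \<open>1 + D\<close> of
  the wavenumber at \<open>m + 1\<close> is controlled by the sum on the left of the intermittency condition.
  Averaging in time, that condition and the bound of \<open>\<Sum>\<^sub>q \<lambda>\<^sub>q\<^sup>2 \<parallel>u\<^sub>q\<parallel>\<^sup>2\<close> by the dissipation give the estimate.
\<close>

text \<open>The pointwise estimate is therefore brought into the shape "constant plus constant times
  one function", a shape that a lower integral still splits. The free parameter \<open>A\<close> in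
  it is chosen only after averaging, and that choice produces the exponent 1 / (1 + D).

  A second constraint is that the constant may depend on neither d nor the solution. From d <= 3 one
  gets D <= 3 - 6/r, so 1 - D >= 6/r - 2, and this gap is positive because r < 3. It bounds the
  geometric sum uniformly in d.

  The subtracted lambda_0 accounts for the times at which scale 0 already meets the defining
  conditions, where no lower bound on any shell can be inferred. At the other times with finite
  wavenumber, the scale one step below it fails them; hence bounds at a failing scale m are stated
  for lambda at m + 1. Where the wavenumber is infinite, every scale fails and the shell sum itself
  is infinite.\<close>

section \<open>Integrals of nonmeasurable functions and trigonometric polynomials\<close>

text \<open>A simple g below the affine expression yields (g - alpha) / beta, which is measurable
  and lies below f; additivity is applied to this function alone. Subtraction in
  \<open>ennreal\<close> truncates at 0, and both comparisons survive the truncation.\<close>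

lemma nn_integral_affine_le:
  fixes f :: "'a \<Rightarrow> ennreal" and \<alpha> \<beta> :: real
  assumes "finite_measure M" and "0 \<le> \<alpha>" and "0 < \<beta>"
  shows "(\<integral>\<^sup>+x. ennreal \<alpha> + ennreal \<beta> * f x \<partial>M) \<le> ennreal \<alpha> * emeasure M (space M) + ennreal \<beta> * (\<integral>\<^sup>+x. f x \<partial>M)"
  unfolding nn_integral_def_finite[of M "\<lambda>x. ennreal \<alpha> + ennreal \<beta> * f x"]
proof (safe intro!: SUP_least)
  fix g :: "'a \<Rightarrow> ennreal"
  assume g: "simple_function M g" "g \<le> (\<lambda>x. ennreal \<alpha> + ennreal \<beta> * f x)" "\<forall>x. g x < top"
  define g' where "g' x = (g x - ennreal \<alpha>) / ennreal \<beta>" for x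
  have gm [measurable]: "g \<in> borel_measurable M"
    using g(1) by (rule borel_measurable_simple_function)
  have g'm [measurable]: "g' \<in> borel_measurable M"
    unfolding g'_def by measurable
  have b: "ennreal \<beta> * (y / ennreal \<beta>) = y" for y :: ennreal
    using assms(3) by (simp add: ennreal_times_divide mult.commute[of "ennreal \<beta>"] ennreal_mult_divide_eq)
  have b': "(ennreal \<beta> * y) / ennreal \<beta> = y" for y :: ennreal
    using assms(3) by (simp add: mult.commute[of "ennreal \<beta>"] ennreal_mult_divide_eq)
  have 1: "g x \<le> ennreal \<alpha> + ennreal \<beta> * g' x" for x
    unfolding g'_def b by (metis diff_add_self_ennreal linorder_le_cases add.commute order_refl add_increasing2 zero_le)
  have 2: "g' x \<le> f x" for x
  proof -
    have "g x - ennreal \<alpha> \<le> ennreal \<beta> * f x"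
      using g(2) by (auto simp: le_fun_def ennreal_minus_le_iff)
    then have "g' x \<le> (ennreal \<beta> * f x) / ennreal \<beta>"
      unfolding g'_def by (rule divide_right_mono_ennreal)
    then show ?thesis by (simp add: b')
  qed
  have "integral\<^sup>S M g = (\<integral>\<^sup>+x. g x \<partial>M)"
    using g(1) by (simp add: nn_integral_eq_simple_integral)
  also have "\<dots> \<le> (\<integral>\<^sup>+x. ennreal \<alpha> + ennreal \<beta> * g' x \<partial>M)"
    by (intro nn_integral_mono 1)
  also have "\<dots> = ennreal \<alpha> * emeasure M (space M) + ennreal \<beta> * (\<integral>\<^sup>+x. g' x \<partial>M)"
    by (subst nn_integral_add) (auto simp: nn_integral_cmult)
  also have "\<dots> \<le> ennreal \<alpha> * emeasure M (space M) + ennreal \<beta> * (\<integral>\<^sup>+x. f x \<partial>M)"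
    by (intro add_left_mono mult_left_mono nn_integral_mono 2) auto
  finally show "integral\<^sup>S M g \<le> \<dots>" .
qed

section \<open>Fourier characters and their integrals over the cell\<close>

definition character :: "real \<Rightarrow> int^3 \<Rightarrow> real^3 \<Rightarrow> complex" where
  "character L k x = cis (2 * pi / L * (int_vec k \<bullet> x))"

lemma int_vec_0 [simp]: "int_vec 0 = 0"
  by (simp add: int_vec_def vec_eq_iff)

lemma int_vec_add: "int_vec (k + m) = int_vec k + int_vec m"
  by (simp add: int_vec_def vec_eq_iff)

lemma int_vec_uminus: "int_vec (- k) = - int_vec k"
  by (simp add: int_vec_def vec_eq_iff)

lemma norm_character [simp]: "norm (character L k x) = 1"
  by (simp add: character_def)

lemma character_0 [simp]: "character L 0 x = 1"
  by (simp add: character_def)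

lemma character_mult: "character L k x * character L m x = character L (k + m) x"
  by (simp add: character_def cis_mult int_vec_add inner_add_left distrib_left)

lemma cnj_character: "cnj (character L k x) = character L (- k) x"
  by (simp add: character_def cis_cnj int_vec_uminus)

lemma continuous_on_character [continuous_intros]: "continuous_on S (character L k)"
  unfolding character_def[abs_def] cis_conv_exp by (intro continuous_intros)

lemma sets_cell [simp, measurable]: "cbox 0 (\<chi> i. L) \<in> sets lebesgue"
  by (simp add: fmeasurable_cbox)

lemma space_torus [simp]: "space (torus L) = cbox 0 (\<chi> i. L)"
  by (simp add: torus_def)

lemma finite_measure_torus: "finite_measure (torus L)"
  unfolding torus_def by (intro finite_measureI) (simp add: emeasure_restrict_space emeasure_lborel_cbox_eq)

lemma continuous_integrable_torus:
  fixes g :: "real^3 \<Rightarrow> 'b::euclidean_space"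
  assumes "continuous_on (cbox 0 (\<chi> i. L)) g"
  shows "integrable (torus L) g"
  unfolding torus_def
  by (rule continuous_imp_integrable[OF assms])

text \<open>For nonzero m the antiderivative cis(w y) / (i w) takes equal values at 0 and L, since w
  L is an integer multiple of 2 pi. The indicator form is the one-coordinate factor in
  \<open>integral_character\<close>.\<close>

lemma integral_cis_interval:
  fixes m :: int
  assumes L: "0 < L"
  shows "integrable lborel (\<lambda>y. indicator {0..L} y *\<^sub>R cis (2 * pi / L * (of_int m * y)))" (is ?int)
    and "(LINT y|lborel. indicator {0..L} y *\<^sub>R cis (2 * pi / L * (of_int m * y))) = (if m = 0 then of_real L else 0)"  (is ?eq)
proof -
  have "has_bochner_integral lborel (\<lambda>y. indicator {0..L} y *\<^sub>R cis (2 * pi / L * (of_int m * y))) (if m = 0 then of_real L else 0)"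
  proof (cases "m = 0")
    case True
    have "has_bochner_integral lborel (\<lambda>y. indicator {0..L} y *\<^sub>R (1::complex)) (of_real L - of_real 0)"
      using L by (intro has_bochner_integral_FTC_Icc) (auto intro!: derivative_eq_intros simp: scaleR_conv_of_real)
    then show ?thesis using True by simp
  next
    case False
    define w where "w = 2 * pi / L * of_int m"
    have w: "w \<noteq> 0" using False L by (simp add: w_def)
    have w': "2 * pi / L * (of_int m * y) = w * y" for y by (simp add: w_def)
    have wL: "w * L = 2 * pi * of_int m" using L by (simp add: w_def)
    let ?F = "\<lambda>y. cis (w * y) / (\<i> * of_real w)"
    have "has_bochner_integral lborel (\<lambda>y. indicator {0..L} y *\<^sub>R cis (w * y)) (?F L - ?F 0)"
    proof (rule has_bochner_integral_FTC_Icc)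
      show "(?F has_vector_derivative cis (w * y)) (at y within {0..L})" for y
      proof -
        have "((\<lambda>z. exp (\<i> * of_real w * z) / (\<i> * of_real w)) has_field_derivative exp (\<i> * of_real w * of_real y)) (at (of_real y))"
          using w by (auto intro!: derivative_eq_intros)
        from has_vector_derivative_real_field[OF this] show ?thesis
          by (simp add: cis_conv_exp mult_ac)
      qed
      show "continuous_on {0..L} (\<lambda>y. cis (w * y))"
        unfolding cis_conv_exp by (intro continuous_intros)
    qed (use L in simp)
    moreover have "cis (w * L) = 1"
      unfolding wL by (simp add: cis_multiple_2pi)
    ultimately show ?thesis using False by (simp only: w') simp
  qed
  then show ?int ?eq by (auto simp: has_bochner_integral_iff)
qed

text \<open>The indicator of the cell and the exponential both factor over coordinates, so the
  integral is a product of one-dimensional ones. The Borel integrand allows the passage from the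
  completed measure to \<open>lborel\<close>, which is an image of a product measure.\<close>

lemma integral_character:
  assumes L: "0 < L"
  shows "(LINT x|torus L. character L k x) = (if k = 0 then of_real (L ^ 3) else 0)"
proof -
  let ?C = "cbox 0 (\<chi> i. L) :: (real^3) set"
  \<comment> \<open>The product measure is indexed by basis vectors, not by the index type of
    \<open>k\<close>; the floor recovers the integer coordinate along \<open>b\<close>.\<close>
  define m where "m b = \<lfloor>int_vec k \<bullet> b\<rfloor>" for b :: "real^3"
  have m: "of_int (m b) = int_vec k \<bullet> b" if "b \<in> Basis" for b
    using that by (auto simp: m_def Basis_vec_def int_vec_def inner_axis)
  have k0: "k = 0 \<longleftrightarrow> (\<forall>b\<in>Basis. m b = 0)"
  proof -
    have "k = 0 \<longleftrightarrow> int_vec k = 0"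
      by (simp add: int_vec_def vec_eq_iff)
    also have "\<dots> \<longleftrightarrow> (\<forall>b\<in>Basis. int_vec k \<bullet> b = 0)"
      using euclidean_eq_iff[of "int_vec k" 0] by auto
    also have "\<dots> \<longleftrightarrow> (\<forall>b\<in>Basis. m b = 0)"
      by (intro ball_cong refl) (metis m of_int_eq_0_iff)
    finally show ?thesis .
  qed
  have side: "(\<chi> i. L) \<bullet> b = L" if "b \<in> Basis" for b :: "real^3"
    using that by (auto simp: Basis_vec_def inner_axis)
  let ?g = "\<lambda>b y. indicator {0..L} y *\<^sub>R cis (2 * pi / L * (of_int (m b) * y)) :: complex"
  have cb: "(\<lambda>x. indicator ?C x *\<^sub>R character L k x) \<in> borel_measurable borel"
    by (intro borel_measurable_scaleR borel_measurable_indicator borel_measurable_continuous_onI continuous_intros) simp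
  interpret product_sigma_finite "\<lambda>b::real^3. lborel :: real measure" ..
  have "(LINT x|torus L. character L k x) = (LINT x|lebesgue. indicator ?C x *\<^sub>R character L k x)"
    unfolding torus_def by (rule integral_restrict_space) simp
  also have "\<dots> = (LINT x|lborel. indicator ?C x *\<^sub>R character L k x)"
    using cb by (intro integral_completion) simp
  also have "\<dots> = (LINT f|(\<Pi>\<^sub>M b\<in>Basis. lborel). indicator ?C (\<Sum>b\<in>Basis. f b *\<^sub>R b) *\<^sub>R character L k (\<Sum>b\<in>Basis. f b *\<^sub>R b))"
    using cb by (subst lborel_eq, intro integral_distr) auto
  also have "\<dots> = (LINT f|(\<Pi>\<^sub>M b\<in>Basis. lborel). (\<Prod>b\<in>Basis. ?g b (f b)))"
  proof (rule Bochner_Integration.integral_cong[OF refl])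
    fix f :: "real^3 \<Rightarrow> real"
    let ?x = "\<Sum>b\<in>Basis. f b *\<^sub>R b"
    have mem: "?x \<in> ?C \<longleftrightarrow> (\<forall>b\<in>Basis. f b \<in> {0..L})"
    proof -
      have "?x \<in> ?C \<longleftrightarrow> (\<forall>b\<in>Basis. 0 \<le> ?x \<bullet> b \<and> ?x \<bullet> b \<le> (\<chi> i. L) \<bullet> b)"
        by (simp add: mem_box)
      also have "\<dots> \<longleftrightarrow> (\<forall>b\<in>Basis. f b \<in> {0..L})"
        by (intro ball_cong refl) (simp add: inner_sum_left_Basis side)
      finally show ?thesis .
    qed
    have ind: "indicator ?C ?x = (\<Prod>b\<in>Basis. indicator {0..L} (f b) :: real)"
      using mem by (auto simp: indicator_def prod_zero_iff)
    have "int_vec k \<bullet> ?x = (\<Sum>b\<in>Basis. of_int (m b) * f b)"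
      by (simp add: inner_sum_right m mult.commute)
    then have ch: "character L k ?x = (\<Prod>b\<in>Basis. cis (2 * pi / L * (of_int (m b) * f b)))"
      by (simp add: character_def cis_conv_exp sum_distrib_left exp_sum)
    show "indicator ?C ?x *\<^sub>R character L k ?x = (\<Prod>b\<in>Basis. ?g b (f b))"
      unfolding ch ind by (simp add: scaleR_conv_of_real prod.distrib)
  qed
  also have "\<dots> = (\<Prod>b\<in>Basis. integral\<^sup>L lborel (?g b))"
    using integral_cis_interval(1)[OF L] by (intro product_integral_prod) auto
  also have "\<dots> = (\<Prod>b\<in>(Basis::(real^3) set). if m b = 0 then of_real L else 0)"
    using integral_cis_interval(2)[OF L] by simp
  also have "\<dots> = (if k = 0 then of_real (L ^ 3) else 0)"
    using k0 by auto
  finally show ?thesis .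
qed

section \<open>Trigonometric polynomials: Parseval, Bessel and Nikolskii estimates\<close>

definition trig_poly :: "real \<Rightarrow> (int^3) set \<Rightarrow> (int^3 \<Rightarrow> complex) \<Rightarrow> real^3 \<Rightarrow> complex" where
  "trig_poly L F a x = (\<Sum>k\<in>F. a k * character L k x)"

lemma continuous_on_trig_poly [continuous_intros]: "continuous_on S (trig_poly L F a)"
  unfolding trig_poly_def[abs_def] by (intro continuous_intros)

lemma norm_trig_poly_le: "norm (trig_poly L F a x) \<le> (\<Sum>k\<in>F. norm (a k))"
  unfolding trig_poly_def by (rule order_trans[OF norm_sum]) (simp add: norm_mult)

text \<open>In the expansion of the square, the cross term and the square of the polynomial both
  integrate to the same multiple of the coefficient sum, entering with factors -2 and +1. With
  \<open>w\<close> the polynomial itself this becomes Parseval's identity; nonnegativity of the left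
  side gives Bessel's inequality.\<close>

lemma bessel_identity:
  fixes w :: "real^3 \<Rightarrow> complex"
  assumes L: "0 < L" and F: "finite F" and w: "integrable (torus L) w"
    and w2: "integrable (torus L) (\<lambda>x. (norm (w x))\<^sup>2)"
    and a: "\<And>k. k \<in> F \<Longrightarrow> a k * of_real (L ^ 3) = (LINT x|torus L. w x * character L (- k) x)"
  shows "(LINT x|torus L. (norm (w x - trig_poly L F a x))\<^sup>2)
     = (LINT x|torus L. (norm (w x))\<^sup>2) - L ^ 3 * (\<Sum>k\<in>F. (norm (a k))\<^sup>2)"
proof -
  have ch: "integrable (torus L) (character L k)" for k
    by (intro continuous_integrable_torus continuous_intros)
  have wch: "integrable (torus L) (\<lambda>x. w x * character L k x)" for k
  proof (rule Bochner_Integration.integrable_bound[OF w])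
    show "(\<lambda>x. w x * character L k x) \<in> borel_measurable (torus L)"
      using w ch[of k] by (intro borel_measurable_times) auto
  qed (simp add: norm_mult)
  let ?p = "trig_poly L F a"
  have norm_sq: "(of_real (norm z))\<^sup>2 = z * cnj z" for z :: complex
    by (metis complex_norm_square of_real_power)
  have cross: "integrable (torus L) (\<lambda>x. w x * cnj (?p x))"
       "(LINT x|torus L. w x * cnj (?p x)) = of_real (L ^ 3 * (\<Sum>k\<in>F. (norm (a k))\<^sup>2))"
  proof -
    have e: "w x * cnj (?p x) = (\<Sum>k\<in>F. cnj (a k) * (w x * character L (- k) x))" for x
      by (simp add: trig_poly_def cnj_character sum_distrib_left mult_ac)
    show "integrable (torus L) (\<lambda>x. w x * cnj (?p x))"
      unfolding e using wch by (intro Bochner_Integration.integrable_sum integrable_mult_right)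
    have "(LINT x|torus L. w x * cnj (?p x)) = (\<Sum>k\<in>F. cnj (a k) * (a k * of_real (L ^ 3)))"
      unfolding e using wch a by (subst Bochner_Integration.integral_sum) auto
    also have "\<dots> = of_real (L ^ 3 * (\<Sum>k\<in>F. (norm (a k))\<^sup>2))"
      by (simp add: sum_distrib_left norm_sq mult_ac)
    finally show "(LINT x|torus L. w x * cnj (?p x)) = \<dots>" .
  qed
  have sq: "integrable (torus L) (\<lambda>x. ?p x * cnj (?p x))"
       "(LINT x|torus L. ?p x * cnj (?p x)) = of_real (L ^ 3 * (\<Sum>k\<in>F. (norm (a k))\<^sup>2))"
  proof -
    have e: "?p x * cnj (?p x) = (\<Sum>k\<in>F. \<Sum>j\<in>F. a k * cnj (a j) * character L (k - j) x)" for x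
      by (simp add: trig_poly_def cnj_character sum_product mult_ac character_mult)
    show "integrable (torus L) (\<lambda>x. ?p x * cnj (?p x))"
      unfolding e using ch by (intro Bochner_Integration.integrable_sum integrable_mult_right)
    have "(LINT x|torus L. ?p x * cnj (?p x)) = (\<Sum>k\<in>F. \<Sum>j\<in>F. a k * cnj (a j) * (if k - j = 0 then of_real (L ^ 3) else 0))"
      unfolding e using ch
      by (subst Bochner_Integration.integral_sum; (intro Bochner_Integration.integrable_sum integrable_mult_right)?; simp add: integral_character[OF L])
    also have "\<dots> = (\<Sum>k\<in>F. \<Sum>j\<in>F. if k = j then a k * cnj (a j) * of_real (L ^ 3) else 0)"
      by (intro sum.cong refl) auto
    also have "\<dots> = (\<Sum>k\<in>F. a k * cnj (a k) * of_real (L ^ 3))"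
      using F by (simp add: sum.delta)
    also have "\<dots> = of_real (L ^ 3 * (\<Sum>k\<in>F. (norm (a k))\<^sup>2))"
      by (simp add: sum_distrib_left norm_sq mult_ac)
    finally show "(LINT x|torus L. ?p x * cnj (?p x)) = \<dots>" .
  qed
  have e: "(norm (w x - ?p x))\<^sup>2 = (norm (w x))\<^sup>2 - 2 * Re (w x * cnj (?p x)) + Re (?p x * cnj (?p x))" for x
    unfolding cmod_power2 by (simp add: power2_eq_square algebra_simps)
  define X Y where "X x = w x * cnj (?p x)" and "Y x = ?p x * cnj (?p x)" for x
  have "(LINT x|torus L. (norm (w x))\<^sup>2 - 2 * Re (X x) + Re (Y x))
      = (LINT x|torus L. (norm (w x))\<^sup>2) - 2 * Re (LINT x|torus L. X x) + Re (LINT x|torus L. Y x)"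
    using w2 cross(1) sq(1) by (simp add: X_def[symmetric] Y_def[symmetric])
  then show ?thesis
    unfolding e X_def Y_def cross(2) sq(2) by simp
qed

lemma parseval_trig_poly:
  assumes L: "0 < L" and F: "finite F"
  shows "(LINT x|torus L. (norm (trig_poly L F a x))\<^sup>2) = L ^ 3 * (\<Sum>k\<in>F. (norm (a k))\<^sup>2)"
proof -
  have "a k * of_real (L ^ 3) = (LINT x|torus L. trig_poly L F a x * character L (- k) x)" if "k \<in> F" for k
  proof -
    have "(LINT x|torus L. trig_poly L F a x * character L (- k) x)
        = (LINT x|torus L. (\<Sum>j\<in>F. a j * character L (j - k) x))"
      by (simp add: trig_poly_def sum_distrib_right mult.assoc character_mult)
    also have "\<dots> = (\<Sum>j\<in>F. a j * (if j - k = 0 then of_real (L ^ 3) else 0))"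
      by (subst Bochner_Integration.integral_sum;
          (intro integrable_mult_right continuous_integrable_torus continuous_intros)?;
          simp add: integral_character[OF L])
    also have "\<dots> = (\<Sum>j\<in>F. if k = j then a j * of_real (L ^ 3) else 0)"
      by (intro sum.cong refl) auto
    also have "\<dots> = a k * of_real (L ^ 3)"
      using F that by (simp add: sum.delta)
    finally show ?thesis ..
  qed
  then have "(LINT x|torus L. (norm (trig_poly L F a x - trig_poly L F a x))\<^sup>2)
     = (LINT x|torus L. (norm (trig_poly L F a x))\<^sup>2) - L ^ 3 * (\<Sum>k\<in>F. (norm (a k))\<^sup>2)"
    by (intro bessel_identity[OF L F] continuous_integrable_torus continuous_intros)
  then show ?thesis by simp
qed

lemma bessel_inequality:
  fixes w :: "real^3 \<Rightarrow> complex"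
  assumes L: "0 < L" and F: "finite F" and w: "integrable (torus L) w"
    and w2: "integrable (torus L) (\<lambda>x. (norm (w x))\<^sup>2)"
  shows "(\<Sum>k\<in>F. (norm (LINT x|torus L. w x * character L (- k) x))\<^sup>2) \<le> L ^ 3 * (LINT x|torus L. (norm (w x))\<^sup>2)"
proof -
  define a where "a k = (LINT x|torus L. w x * character L (- k) x) / of_real (L ^ 3)" for k
  have "0 \<le> (LINT x|torus L. (norm (w x - trig_poly L F a x))\<^sup>2)"
    by simp
  also have "\<dots> = (LINT x|torus L. (norm (w x))\<^sup>2) - L ^ 3 * (\<Sum>k\<in>F. (norm (a k))\<^sup>2)"
    using L by (intro bessel_identity[OF L F w w2]) (simp add: a_def)
  finally have "L ^ 3 * (L ^ 3 * (\<Sum>k\<in>F. (norm (a k))\<^sup>2)) \<le> L ^ 3 * (LINT x|torus L. (norm (w x))\<^sup>2)"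
    using L by (intro mult_left_mono) auto
  moreover have "(norm (LINT x|torus L. w x * character L (- k) x))\<^sup>2 = L ^ 3 * (L ^ 3 * (norm (a k))\<^sup>2)" for k
    using L by (simp add: a_def norm_divide norm_power power_divide power2_eq_square)
  ultimately show ?thesis
    by (simp add: sum_distrib_left)
qed

text \<open>Bernstein's inequality from L^2 to the supremum: Cauchy-Schwarz over the coefficients
  costs the number of frequencies, and Parseval turns the coefficient sum into an integral.\<close>

lemma trig_poly_sup_le_L2:
  assumes L: "0 < L" and F: "finite F"
  shows "(norm (trig_poly L F a x))\<^sup>2 \<le> card F / L ^ 3 * (LINT x|torus L. (norm (trig_poly L F a x))\<^sup>2)"
proof -
  have "(norm (trig_poly L F a x))\<^sup>2 \<le> (\<Sum>k\<in>F. norm (a k))\<^sup>2"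
    by (intro power_mono norm_trig_poly_le) simp
  also have "\<dots> \<le> card F * (\<Sum>k\<in>F. (norm (a k))\<^sup>2)"
    using Cauchy_Schwarz_ineq_sum[of "\<lambda>_. 1" "\<lambda>k. norm (a k)" F] by simp
  also have "\<dots> = card F / L ^ 3 * (LINT x|torus L. (norm (trig_poly L F a x))\<^sup>2)"
    using L by (simp add: parseval_trig_poly[OF L F])
  finally show ?thesis .
qed

text \<open>The coefficients of the square are the convolution of \<open>a\<close> with itself,
  supported in the sumset F + F. The size of that sumset becomes the constant in
  \<open>trig_poly_nikolskii\<close>.\<close>

lemma trig_poly_square:
  assumes "finite F"
  shows "\<exists>b. \<forall>x. (trig_poly L F a x)\<^sup>2 = trig_poly L ((\<lambda>(j, k). j + k) ` (F \<times> F)) b x"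
proof -
  let ?s = "\<lambda>(j, k). j + k :: int^3"
  define b where "b m = (\<Sum>p | p \<in> F \<times> F \<and> ?s p = m. a (fst p) * a (snd p))" for m
  have "(trig_poly L F a x)\<^sup>2 = trig_poly L (?s ` (F \<times> F)) b x" for x
  proof -
    have "(trig_poly L F a x)\<^sup>2 = (\<Sum>(j, k)\<in>F \<times> F. a j * a k * character L (j + k) x)"
      by (simp add: power2_eq_square trig_poly_def sum_product sum.cartesian_product character_mult[symmetric] mult_ac)
    also have "\<dots> = (\<Sum>m\<in>?s ` (F \<times> F). \<Sum>p | p \<in> F \<times> F \<and> ?s p = m. (case p of (j, k) \<Rightarrow> a j * a k * character L (j + k) x))"
      using assms by (intro sum.image_gen) auto
    also have "\<dots> = (\<Sum>m\<in>?s ` (F \<times> F). \<Sum>p | p \<in> F \<times> F \<and> ?s p = m. a (fst p) * a (snd p) * character L m x)"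
      by (intro sum.cong refl) auto
    also have "\<dots> = trig_poly L (?s ` (F \<times> F)) b x"
      by (simp add: trig_poly_def b_def sum_distrib_right)
    finally show ?thesis .
  qed
  then show ?thesis by blast
qed

text \<open>For exponents above 2 the inequality is applied to the square of the polynomial, whose exponent
  \<open>r / 2\<close> lies below 2: there the \<open>L\<^sup>2\<close> bound interpolates against the supremum.\<close>

lemma trig_poly_nikolskii:
  assumes L: "0 < L" and F: "finite F" and r: "2 \<le> r" "r \<le> 4"
  shows "norm (trig_poly L F a x) powr r
    \<le> card ((\<lambda>(j, k). j + k) ` (F \<times> F)) / L ^ 3 * (LINT x|torus L. norm (trig_poly L F a x) powr r)"
proof -
  let ?F2 = "(\<lambda>(j, k). j + k) ` (F \<times> F)"
  let ?g = "trig_poly L F a"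
  define A where "A = card ?F2 / L ^ 3"
  define S where "S = (SUP x. norm (?g x))"
  obtain b where b: "\<And>x. (?g x)\<^sup>2 = trig_poly L ?F2 b x"
    using trig_poly_square[OF F] by metis
  have bdd: "bdd_above (range (\<lambda>x. norm (?g x)))"
    using norm_trig_poly_le by (intro bdd_aboveI) auto
  have le_S: "norm (?g x) \<le> S" for x
    unfolding S_def by (rule cSUP_upper[OF _ bdd]) simp
  have S0: "0 \<le> S" using le_S[of 0] norm_ge_zero order_trans by blast
  have A0: "0 \<le> A" using L by (simp add: A_def)
  have int_r: "integrable (torus L) (\<lambda>x. norm (?g x) powr r)"
    using r by (intro continuous_integrable_torus continuous_on_powr' continuous_intros) auto
  define I where "I = (LINT x|torus L. norm (?g x) powr r)"
  have pw: "norm (?g x) ^ 4 \<le> S powr (4 - r) * norm (?g x) powr r" for x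
  proof (cases "?g x = 0")
    case False
    then have "norm (?g x) ^ 4 = norm (?g x) powr (4 - r) * norm (?g x) powr r"
      by (simp flip: powr_add)
    also have "\<dots> \<le> S powr (4 - r) * norm (?g x) powr r"
      using le_S r by (intro mult_right_mono powr_mono2) auto
    finally show ?thesis .
  qed simp
  \<comment> \<open>The unknown supremum S occurs on the right with exponent 4 - r < 4. Taking the
    supremum over x on the left gives S^4 there, and cancelling S^(4 - r) leaves the bound on S^r;
    this cancellation is why S = 0 is split off.\<close>
  have main: "norm (?g x) ^ 4 \<le> A * S powr (4 - r) * I" for x
  proof -
    have "norm (?g x) ^ 4 = (norm ((?g x)\<^sup>2))\<^sup>2"
      by (simp add: norm_power)
    also have "\<dots> \<le> A * (LINT x|torus L. (norm ((?g x)\<^sup>2))\<^sup>2)"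
      unfolding b A_def using F by (intro trig_poly_sup_le_L2[OF L]) auto
    also have "(LINT x|torus L. (norm ((?g x)\<^sup>2))\<^sup>2) = (LINT x|torus L. norm (?g x) ^ 4)"
      by (simp add: norm_power)
    also have "\<dots> \<le> (LINT x|torus L. S powr (4 - r) * norm (?g x) powr r)"
      by (intro integral_mono pw integrable_mult_right int_r continuous_integrable_torus continuous_intros)
    also have "\<dots> = S powr (4 - r) * I"
      by (simp add: I_def)
    finally show ?thesis using A0 by (simp add: mult_left_mono mult.assoc)
  qed
  show ?thesis
  proof (cases "S = 0")
    case True
    then have "?g x = 0" for x using le_S[of x] by simp
    then show ?thesis by simp
  next
    case False
    with S0 have S: "0 < S" by simp
    have I0: "0 \<le> I" by (simp add: I_def)
    have "S \<le> (A * S powr (4 - r) * I) powr (1/4)"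
      unfolding S_def
    proof (rule cSUP_least)
      fix x
      have "norm (?g x) = (norm (?g x) ^ 4) powr (1/4)"
        by (cases "?g x = 0") (simp_all add: powr_powr flip: powr_numeral)
      also have "\<dots> \<le> (A * (SUP x. norm (?g x)) powr (4 - r) * I) powr (1/4)"
        using main[of x] unfolding S_def by (intro powr_mono2) auto
      finally show "norm (?g x) \<le> \<dots>" .
    qed simp
    then have "S powr 4 \<le> ((A * S powr (4 - r) * I) powr (1/4)) powr 4"
      using S by (intro powr_mono2) auto
    also have "\<dots> = A * S powr (4 - r) * I"
      using A0 I0 by (simp add: powr_powr)
    finally have "S powr r * S powr (4 - r) \<le> A * I * S powr (4 - r)"
      by (simp add: mult_ac flip: powr_add)
    then have "S powr r \<le> A * I"
      using S by simp
    moreover have "norm (?g x) powr r \<le> S powr r"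
      using le_S r by (intro powr_mono2) auto
    ultimately show ?thesis unfolding A_def I_def by linarith
  qed
qed

section \<open>Littlewood-Paley projections\<close>

text \<open>Induction on the largest element b: the others are at most b - 1, and x/(x-1) * x^(b-1)
  + x^b = x/(x-1) * x^b, so the constant reproduces itself. Arbitrary finite sets are allowed
  because the shells that see a given frequency need not be shown to form an interval.\<close>

lemma sum_powi_le:
  fixes x :: real
  assumes x: "1 < x" and A: "finite A" and m: "\<And>q. q \<in> A \<Longrightarrow> q \<le> m"
  shows "(\<Sum>q\<in>A. x powi q) \<le> x / (x - 1) * x powi m"
  using A m
proof (induction A arbitrary: m rule: finite_linorder_max_induct)
  case empty
  then show ?case using x by simp
next
  case (insert b A)
  have "(\<Sum>q\<in>A. x powi q) \<le> x / (x - 1) * x powi (b - 1)"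
    using insert by (intro insert.IH) force
  then have "(\<Sum>q\<in>insert b A. x powi q) \<le> x powi b + x / (x - 1) * x powi (b - 1)"
    using insert.hyps by (subst sum.insert) auto
  also have "\<dots> = x / (x - 1) * x powi b"
    using x by (simp add: power_int_diff field_simps)
  also have "\<dots> \<le> x / (x - 1) * x powi m"
    using x insert.prems by (intro mult_left_mono power_int_increasing) auto
  finally show ?case .
qed

lemma LP_cutoffD:
  assumes "LP_cutoff chi"
  shows "continuous_on UNIV chi" and "0 \<le> chi \<xi>" and "norm \<xi> \<le> 3/4 \<Longrightarrow> chi \<xi> = 1"
    and "1 \<le> norm \<xi> \<Longrightarrow> chi \<xi> = 0"
proof -
  have "Ck_on 0 UNIV chi" using assms unfolding LP_cutoff_def smooth_on_def by blast
  then show "continuous_on UNIV chi" by simp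
qed (use assms in \<open>unfold LP_cutoff_def; blast\<close>)+

text \<open>An upper bound for the cutoff is not among the clauses of \<open>LP_cutoff\<close>;
  compactness of the unit ball supplies one, and its square enters the final constant.\<close>

lemma LP_cutoff_bounded:
  assumes "LP_cutoff chi"
  obtains M where "0 < M" and "\<And>\<xi>. chi \<xi> \<le> M"
proof -
  have "compact (chi ` cball 0 1)"
    by (intro compact_continuous_image continuous_on_subset[OF LP_cutoffD(1)[OF assms]]) auto
  then obtain b where b: "\<forall>y\<in>chi ` cball 0 1. norm y \<le> b"
    using compact_imp_bounded bounded_iff by metis
  have "chi \<xi> \<le> max b 1" for \<xi>
  proof (cases "norm \<xi> \<le> 1")
    case True
    then have "norm (chi \<xi>) \<le> b" using b by auto
    then show ?thesis by auto
  next
    case False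
    then show ?thesis using LP_cutoffD(4)[OF assms, of \<xi>] by simp
  qed
  then show ?thesis by (intro that[of "max b 1"]) auto
qed

section \<open>Frequency support of the shells and lattice point counts\<close>

lemma abs_LP_symbol_le:
  assumes chi: "LP_cutoff chi" and M: "\<And>\<xi>. chi \<xi> \<le> M"
  shows "\<bar>LP_symbol chi q \<xi>\<bar> \<le> M"
proof -
  note nonneg = LP_cutoffD(2)[OF chi]
  have "\<bar>chi \<eta>\<bar> \<le> M" "\<bar>chi \<eta> - chi \<zeta>\<bar> \<le> M" for \<eta> \<zeta>
    using M[of \<eta>] M[of \<zeta>] nonneg[of \<eta>] nonneg[of \<zeta>] by linarith+
  then show ?thesis by (simp add: LP_symbol_def)
qed

lemma LP_symbol_eq_0_high:
  assumes chi: "LP_cutoff chi" and q: "-1 \<le> q" and \<xi>: "2 powi (q + 1) \<le> norm \<xi>"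
  shows "LP_symbol chi q \<xi> = 0"
proof -
  note z = LP_cutoffD(4)[OF chi]
  have p: "2 powi q * 2 \<le> norm \<xi>" using \<xi> by (simp add: power_int_add)
  show ?thesis
  proof (cases "q = -1")
    case True
    then show ?thesis using \<xi> by (auto simp: LP_symbol_def z)
  next
    case False
    have "2 powi q \<le> 2 powi q * (2::real)" by simp
    then have p': "2 powi q \<le> norm \<xi>" using p by (rule order_trans)
    have "1 \<le> norm ((2 powi (-q) / 2) *\<^sub>R \<xi>)"
      using p by (simp add: power_int_minus field_simps)
    moreover have "1 \<le> norm (2 powi (-q) *\<^sub>R \<xi>)"
      using p' by (simp add: power_int_minus field_simps)
    ultimately show ?thesis using False by (simp add: LP_symbol_def z)
  qed
qed

lemma LP_symbol_eq_0_low: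
  assumes chi: "LP_cutoff chi" and q: "0 \<le> q" and \<xi>: "norm \<xi> \<le> 3/4 * 2 powi q"
  shows "LP_symbol chi q \<xi> = 0"
proof -
  note one = LP_cutoffD(3)[OF chi]
  have "norm (2 powi (-q) *\<^sub>R \<xi>) \<le> 3/4" using \<xi> by (simp add: power_int_minus field_simps)
  moreover have "norm ((2 powi (-q) / 2) *\<^sub>R \<xi>) \<le> norm (2 powi (-q) *\<^sub>R \<xi>)"
    unfolding norm_scaleR by (intro mult_right_mono) auto
  ultimately have "chi (2 powi (-q) *\<^sub>R \<xi>) = 1" "chi ((2 powi (-q) / 2) *\<^sub>R \<xi>) = 1"
    using one order_trans by blast+
  then show ?thesis using q by (simp add: LP_symbol_def)
qed

text \<open>A full ball containing the support of the q-th symbol. Balls, unlike dyadic annuli,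
  behave well under sums: two frequencies of \<open>freq_ball q\<close> add up to one of
  \<open>freq_ball (q + 1)\<close>.\<close>

definition freq_ball :: "int \<Rightarrow> (int^3) set" where
  "freq_ball q = {k. norm (int_vec k) \<le> 2 powi (q + 1)}"

lemma finite_card_int_box:
  fixes N :: int
  assumes "0 \<le> N"
  shows "finite {k :: int^3. \<forall>i. \<bar>k $ i\<bar> \<le> N}"
    and "card {k :: int^3. \<forall>i. \<bar>k $ i\<bar> \<le> N} \<le> nat (2 * N + 1) ^ 3"
proof -
  let ?B = "{k :: int^3. \<forall>i. \<bar>k $ i\<bar> \<le> N}" and ?P = "PiE (UNIV::3 set) (\<lambda>_. {-N..N})"
  have sub: "vec_nth ` ?B \<subseteq> ?P" by (auto simp: abs_le_iff minus_le_iff)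
  have inj: "inj_on vec_nth ?B" by (auto simp: inj_on_def vec_nth_inject)
  have fin: "finite ?P" by (intro finite_PiE) auto
  show "finite ?B" by (rule finite_imageD[OF finite_subset[OF sub fin] inj])
  have "card ?B \<le> card ?P" by (rule card_inj_on_le[OF inj sub fin])
  also have "\<dots> = nat (2 * N + 1) ^ 3"
    by (subst card_PiE) (auto simp: algebra_simps power3_eq_cube)
  finally show "card ?B \<le> nat (2 * N + 1) ^ 3" .
qed

lemma finite_card_freq_ball:
  assumes q: "-1 \<le> q"
  shows "finite (freq_ball q)" and "real (card (freq_ball q)) \<le> (6 * 2 powi q) ^ 3"
proof -
  define N where "N = \<lfloor>2 powi (q + 1) :: real\<rfloor>"
  have N0: "0 \<le> N" by (simp add: N_def)
  have sub: "freq_ball q \<subseteq> {k. \<forall>i. \<bar>k $ i\<bar> \<le> N}"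
  proof (clarsimp simp: freq_ball_def)
    fix k :: "int^3" and i assume "norm (int_vec k) \<le> 2 powi (q + 1)"
    then have "\<bar>int_vec k $ i\<bar> \<le> 2 powi (q + 1)" using component_le_norm_cart order_trans by blast
    then show "\<bar>k $ i\<bar> \<le> N" by (simp add: int_vec_def N_def le_floor_iff)
  qed
  show "finite (freq_ball q)" using finite_card_int_box(1)[OF N0] sub finite_subset by blast
  have "card (freq_ball q) \<le> nat (2 * N + 1) ^ 3"
    using finite_card_int_box[OF N0] sub card_mono order_trans by meson
  then have "real (card (freq_ball q)) \<le> real (nat (2 * N + 1)) ^ 3"
    by (metis of_nat_le_iff of_nat_power)
  also have "\<dots> \<le> (6 * 2 powi q) ^ 3"
  proof (intro power_mono)
    have "real (nat (2 * N + 1)) = 2 * of_int N + 1" using N0 by simp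
    also have "\<dots> \<le> 2 * 2 powi (q + 1) + 1" by (simp add: N_def)
    \<comment> \<open>Since q >= -1, the summand 1 is at most 2^(q+1) = 2 * 2^q; together with 4 *
      2^q this makes the constant 6.\<close>
    also have "\<dots> \<le> 2 * 2 powi (q + 1) + 2 * 2 powi q"
      using power_int_increasing[of 0 "q + 1" "2::real"] q by (simp add: power_int_add)
    finally show "real (nat (2 * N + 1)) \<le> 6 * 2 powi q" by (simp add: power_int_add)
  qed simp
  finally show "real (card (freq_ball q)) \<le> (6 * 2 powi q) ^ 3" .
qed

lemma freq_ball_add: "(\<lambda>(j, k). j + k) ` (freq_ball q \<times> freq_ball q) \<subseteq> freq_ball (q + 1)"
proof -
  have "j + k \<in> freq_ball (q + 1)" if "j \<in> freq_ball q" "k \<in> freq_ball q" for j k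
  proof -
    have "norm (int_vec (j + k)) \<le> norm (int_vec j) + norm (int_vec k)"
      by (simp add: int_vec_add norm_triangle_ineq)
    also have "\<dots> \<le> 2 powi (q + 1 + 1)"
      using that by (simp add: freq_ball_def power_int_add)
    finally show ?thesis by (simp add: freq_ball_def)
  qed
  then show ?thesis by auto
qed

lemma norm_int_vec_ge_1:
  assumes "k \<noteq> 0"
  shows "1 \<le> norm (int_vec k)"
proof -
  obtain i where "k $ i \<noteq> 0" using assms by (auto simp: vec_eq_iff)
  then have "1 \<le> \<bar>int_vec k $ i\<bar>" by (simp add: int_vec_def)
  then show ?thesis using component_le_norm_cart order_trans by blast
qed

text \<open>Outside the ball the symbol vanishes, so the infinite sum is finite and each component
  is a scalar trigonometric polynomial, to which the estimates above apply.\<close>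

lemma LP_proj_component:
  assumes chi: "LP_cutoff chi" and q: "-1 \<le> q"
  shows "LP_proj chi L q v x $ i =
    trig_poly L (freq_ball q) (\<lambda>k. of_real (LP_symbol chi q (int_vec k)) * fourier_coeff L v k $ i) x"
proof -
  let ?h = "\<lambda>k. (of_real (LP_symbol chi q (int_vec k)) * cis (2 * pi / L * (int_vec k \<bullet> x))) *s fourier_coeff L v k"
  have fin: "finite (freq_ball q)" using q by (intro finite_card_freq_ball) simp
  have "?h k = 0" if "k \<notin> freq_ball q" for k
    using that LP_symbol_eq_0_high[OF chi q, of "int_vec k"] by (simp add: freq_ball_def)
  then have "LP_proj chi L q v x = infsum ?h (freq_ball q)"
    unfolding LP_proj_def by (intro infsum_cong_neutral) auto
  also have "\<dots> = (\<Sum>k\<in>freq_ball q. ?h k)"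
    using fin by (rule infsum_finite)
  finally show ?thesis
    by (simp add: sum_component trig_poly_def character_def mult_ac)
qed

lemma continuous_on_LP_proj:
  assumes "LP_cutoff chi" and "-1 \<le> q"
  shows "continuous_on S (LP_proj chi L q v)"
proof -
  have "continuous_on S (\<lambda>x. \<chi> i. LP_proj chi L q v x $ i)"
    unfolding LP_proj_component[OF assms] by (intro continuous_intros)
  then show ?thesis by simp
qed

section \<open>Bernstein's inequality for the projections\<close>

lemma norm_le_sum_components: "norm (w :: 'a::real_normed_vector^'n) \<le> (\<Sum>i\<in>UNIV. norm (w $ i))"
  unfolding norm_vec_def by (intro L2_set_le_sum) simp

lemma norm_sq_components: "(norm (w :: 'a::real_normed_vector^'n))\<^sup>2 = (\<Sum>i\<in>UNIV. (norm (w $ i))\<^sup>2)"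
  unfolding norm_vec_def L2_set_def by (simp add: sum_nonneg)

text \<open>Nikolskii's inequality applied to each of the 3 components. The sumset lies in
  \<open>freq_ball (q + 1)\<close>, with at most (6 * 2^(q+1))^3 = 1728 * (2^q)^3 points, and
  (2^q)^3 / L^3 is the cube of the q-th frequency.\<close>

lemma bernstein_LP_proj:
  assumes chi: "LP_cutoff chi" and L: "0 < L" and r: "2 \<le> r" "r \<le> 4" and q: "-1 \<le> q"
  shows "norm (LP_proj chi L q v x) \<le> 3 * 1728 powr (1 / r) * LP_freq L q powr (3 / r) * Lp_norm L r (LP_proj chi L q v)"
proof -
  let ?p = "LP_proj chi L q v"
  let ?F = "freq_ball q"
  define I where "I = (LINT x|torus L. norm (?p x) powr r)"
  have I0: "0 \<le> I" by (simp add: I_def)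
  have fin: "finite ?F" "finite (freq_ball (q + 1))" using q by (intro finite_card_freq_ball; simp)+
  have int: "integrable (torus L) (\<lambda>x. norm (?p x) powr r)" "integrable (torus L) (\<lambda>x. norm (?p x $ i) powr r)" for i
    using r by (intro continuous_integrable_torus continuous_on_powr' continuous_intros continuous_on_LP_proj chi q; auto)+
  have lam: "0 < LP_freq L q" using L by (simp add: LP_freq_def)
  have comp: "norm (?p x $ i) \<le> 1728 powr (1 / r) * LP_freq L q powr (3 / r) * Lp_norm L r ?p" for i
  proof -
    obtain a where a: "\<And>y. ?p y $ i = trig_poly L ?F a y"
      using LP_proj_component[OF chi q] by blast
    have "real (card ((\<lambda>(j, k). j + k) ` (?F \<times> ?F))) \<le> real (card (freq_ball (q + 1)))"
      using fin freq_ball_add by (intro of_nat_mono card_mono) auto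
    also have "\<dots> \<le> (6 * 2 powi (q + 1)) ^ 3"
      using q by (intro finite_card_freq_ball) simp
    also have "\<dots> = 1728 * LP_freq L q ^ 3 * L ^ 3"
      using L by (simp add: LP_freq_def power_int_add power_mult_distrib power_divide)
    finally have card: "real (card ((\<lambda>(j, k). j + k) ` (?F \<times> ?F))) / L ^ 3 \<le> 1728 * LP_freq L q ^ 3"
      using L by (simp add: field_simps)
    have "norm (?p x $ i) powr r \<le> card ((\<lambda>(j, k). j + k) ` (?F \<times> ?F)) / L ^ 3 * (LINT x|torus L. norm (?p x $ i) powr r)"
      unfolding a using trig_poly_nikolskii[OF L fin(1) r] by blast
    also have "\<dots> \<le> (1728 * LP_freq L q ^ 3) * I"
      unfolding I_def using r int
      by (intro mult_mono card integral_mono powr_mono2 Finite_Cartesian_Product.norm_nth_le) (use lam in auto)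
    finally have "(norm (?p x $ i) powr r) powr (1 / r) \<le> (1728 * LP_freq L q ^ 3 * I) powr (1 / r)"
      using r by (intro powr_mono2) auto
    also have "\<dots> = 1728 powr (1 / r) * (LP_freq L q powr 3) powr (1 / r) * I powr (1 / r)"
      using lam I0 by (simp add: powr_mult)
    finally show ?thesis
      using r by (simp add: powr_powr Lp_norm_def I_def)
  qed
  have "norm (?p x) \<le> (\<Sum>i\<in>UNIV. norm (?p x $ i))"
    by (rule norm_le_sum_components)
  also have "\<dots> \<le> (\<Sum>i\<in>(UNIV::3 set). 1728 powr (1 / r) * LP_freq L q powr (3 / r) * Lp_norm L r ?p)"
    by (intro sum_mono comp)
  finally show ?thesis by simp
qed

lemma Linf_norm_le:
  assumes "\<And>x. norm (v x) \<le> M"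
  shows "Linf_norm L v \<le> M"
  unfolding Linf_norm_def
proof (rule cInf_lower)
  show "M \<in> {M. 0 \<le> M \<and> (AE x in torus L. norm (v x) \<le> M)}"
    using assms order_trans[OF norm_ge_zero] by auto
qed (auto intro: bdd_belowI)

lemma Linf_norm_LP_low_le:
  assumes chi: "LP_cutoff chi" and L: "0 < L" and r: "2 \<le> r" "r \<le> 4"
  shows "Linf_norm L (LP_low chi L q v)
    \<le> 3 * 1728 powr (1 / r) * (\<Sum>p = -1..q. LP_freq L p powr (3 / r) * Lp_norm L r (LP_proj chi L p v))"
proof (rule Linf_norm_le)
  fix x
  have "norm (LP_low chi L q v x) \<le> (\<Sum>p = -1..q. norm (LP_proj chi L p v x))"
    unfolding LP_low_def by (rule norm_sum)
  also have "\<dots> \<le> (\<Sum>p = -1..q. 3 * 1728 powr (1 / r) * LP_freq L p powr (3 / r) * Lp_norm L r (LP_proj chi L p v))"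
    by (intro sum_mono bernstein_LP_proj[OF chi L r]) auto
  finally show "norm (LP_low chi L q v x) \<le> 3 * 1728 powr (1 / r) * (\<Sum>p = -1..q. LP_freq L p powr (3 / r) * Lp_norm L r (LP_proj chi L p v))"
    by (simp add: sum_distrib_left mult.assoc)
qed

section \<open>Fourier coefficients of weak gradients\<close>

lemma Lp_norm_2_sq: "(Lp_norm L 2 v)\<^sup>2 = (LINT x|torus L. (norm (v x))\<^sup>2)"
proof -
  have "(Lp_norm L 2 v)\<^sup>2 = Lp_norm L 2 v powr 2"
    by (simp add: Lp_norm_def)
  also have "\<dots> = (LINT x|torus L. (norm (v x))\<^sup>2)"
    by (simp add: Lp_norm_def powr_powr)
  finally show ?thesis .
qed

lemma L2_torus_integrable:
  assumes "v \<in> L2_torus L"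
  shows "integrable (torus L) v"
proof -
  interpret finite_measure "torus L" by (rule finite_measure_torus)
  have "integrable (torus L) (\<lambda>x. 1 + (norm (v x))\<^sup>2)"
    using assms by (auto simp: L2_torus_def)
  then show ?thesis
  proof (rule Bochner_Integration.integrable_bound)
    show "v \<in> borel_measurable (torus L)" using assms by (simp add: L2_torus_def)
    have "y \<le> 1 + y\<^sup>2" for y :: real
      using zero_le_power2[of "y - 1/2"] by (simp add: power2_eq_square algebra_simps)
    then show "AE x in torus L. norm (v x) \<le> norm (1 + (norm (v x))\<^sup>2)"
      by (auto intro: order_trans)
  qed
qed

text \<open>A directional derivative stays in this two-parameter family, with coefficients depending
  on the direction. This is why the induction over the order of differentiability keeps both
  coefficients arbitrary.\<close>

lemma smooth_on_trig:
  "smooth_on UNIV (\<lambda>x. \<alpha> * cos (\<theta> \<bullet> x) + \<beta> * sin (\<theta> \<bullet> (x::'a::euclidean_space)) :: real)"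
  unfolding smooth_on_def
proof
  fix n
  show "Ck_on n UNIV (\<lambda>x. \<alpha> * cos (\<theta> \<bullet> x) + \<beta> * sin (\<theta> \<bullet> (x::'a)) :: real)"
  proof (induction n arbitrary: \<alpha> \<beta>)
    case 0
    show ?case by (auto intro!: continuous_intros)
  next
    case (Suc n)
    let ?g = "\<lambda>x v. (\<beta> * (\<theta> \<bullet> v)) * cos (\<theta> \<bullet> x) + (- \<alpha> * (\<theta> \<bullet> v)) * sin (\<theta> \<bullet> (x::'a))"
    have "((\<lambda>x. \<alpha> * cos (\<theta> \<bullet> x) + \<beta> * sin (\<theta> \<bullet> x)) has_derivative ?g x) (at x within UNIV)" for x
      by (auto intro!: derivative_eq_intros simp: fun_eq_iff algebra_simps)
    moreover have "Ck_on n UNIV (\<lambda>x. ?g x v)" for v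
      by (rule Suc.IH)
    ultimately show ?case
      unfolding Ck_on.simps by (intro exI[of _ ?g]) blast
  qed
qed

text \<open>Weak gradients are tested against real functions only, so the exponential is split into
  cosine and sine. Both are L-periodic because \<open>k\<close> is integral; testing with each gives
  the real and the imaginary part.\<close>

lemma fourier_weak_grad:
  assumes L: "0 < L" and v: "v \<in> L2_torus L" and G: "has_weak_grad L v G"
  shows "(LINT x|torus L. of_real (G x $ i $ j) * character L (- k) x)
    = \<i> * of_real (2 * pi / L * of_int (k $ j)) * (LINT x|torus L. of_real (v x $ i) * character L (- k) x)"
proof -
  define \<theta> where "\<theta> = (2 * pi / L) *\<^sub>R int_vec k"
  define c where "c = 2 * pi / L * of_int (k $ j)"
  have \<theta>j: "\<theta> \<bullet> axis j 1 = c"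
    by (simp add: \<theta>_def c_def inner_axis int_vec_def)
  have vi: "integrable (torus L) (\<lambda>x. v x $ i)"
    using L2_torus_integrable[OF v] by (rule integrable_bounded_linear[OF bounded_linear_vec_nth])
  have Gi: "integrable (torus L) (\<lambda>x. G x $ i $ j)"
  proof -
    have "integrable (torus L) G" using G L2_torus_integrable by (auto simp: has_weak_grad_def)
    then show ?thesis
      by (intro integrable_bounded_linear[OF bounded_linear_vec_nth[of j]] integrable_bounded_linear[OF bounded_linear_vec_nth[of i]])
  qed
  have prod_int: "integrable (torus L) (\<lambda>x. f x * t (\<theta> \<bullet> x))"
    if f: "integrable (torus L) f" and t: "continuous_on UNIV t" "\<And>y. \<bar>t y\<bar> \<le> 1" for f t :: "_ \<Rightarrow> real"
  proof (rule Bochner_Integration.integrable_bound[OF f])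
    have "integrable (torus L) (\<lambda>x. t (\<theta> \<bullet> x))"
      by (intro continuous_integrable_torus continuous_on_compose2[OF t(1)] continuous_intros) auto
    then show "(\<lambda>x. f x * t (\<theta> \<bullet> x)) \<in> borel_measurable (torus L)"
      using f by (intro borel_measurable_times) auto
    have "\<bar>f x\<bar> * \<bar>t (\<theta> \<bullet> x)\<bar> \<le> \<bar>f x\<bar>" for x
      by (intro mult_left_le t) auto
    then show "AE x in torus L. norm (f x * t (\<theta> \<bullet> x)) \<le> norm (f x)"
      by (simp add: abs_mult)
  qed
  have ci: "continuous_on UNIV (cos :: real \<Rightarrow> real)" "continuous_on UNIV (sin :: real \<Rightarrow> real)"
    by (intro continuous_intros)+
  define Vc Vs Gc Gs where "Vc = (LINT x|torus L. v x $ i * cos (\<theta> \<bullet> x))"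
    and "Vs = (LINT x|torus L. v x $ i * sin (\<theta> \<bullet> x))"
    and "Gc = (LINT x|torus L. G x $ i $ j * cos (\<theta> \<bullet> x))"
    and "Gs = (LINT x|torus L. G x $ i $ j * sin (\<theta> \<bullet> x))"
  have ch: "character L (- k) x = Complex (cos (\<theta> \<bullet> x)) (- sin (\<theta> \<bullet> x))" for x
    by (simp add: character_def int_vec_uminus \<theta>_def complex_eq_iff)
  have complex_split: "(LINT x|torus L. of_real (A x) - \<i> * of_real (B x)) = Complex (LINT x|torus L. A x) (- (LINT x|torus L. B x))"
    if "integrable (torus L) A" "integrable (torus L) B" for A B :: "real^3 \<Rightarrow> real"
    using that by (simp add: complex_eq_iff)
  have split: "(LINT x|torus L. of_real (f x) * character L (- k) x)
      = Complex (LINT x|torus L. f x * cos (\<theta> \<bullet> x)) (- (LINT x|torus L. f x * sin (\<theta> \<bullet> x)))"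
    if f: "integrable (torus L) f" for f
  proof -
    have e: "of_real (f x) * character L (- k) x = of_real (f x * cos (\<theta> \<bullet> x)) - \<i> * of_real (f x * sin (\<theta> \<bullet> x))" for x
      by (simp add: ch complex_eq_iff)
    show ?thesis
      unfolding e by (intro complex_split prod_int f ci) auto
  qed
  have weak: "- (LINT x|torus L. G x $ i $ j * (\<alpha> * cos (\<theta> \<bullet> x) + \<beta> * sin (\<theta> \<bullet> x)))
      = (LINT x|torus L. v x $ i * (\<beta> * c * cos (\<theta> \<bullet> x) - \<alpha> * c * sin (\<theta> \<bullet> x)))" for \<alpha> \<beta>
  proof -
    let ?\<psi> = "\<lambda>x. \<alpha> * cos (\<theta> \<bullet> x) + \<beta> * sin (\<theta> \<bullet> x)"
    have per: "cell_periodic L ?\<psi>"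
    proof -
      have "\<theta> \<bullet> (x + axis m L) = \<theta> \<bullet> x + 2 * pi * of_int (k $ m)" for x m
        using L by (simp add: inner_add_right \<theta>_def inner_axis int_vec_def)
      then show ?thesis by (simp add: cell_periodic_def sin_add cos_add)
    qed
    have "(?\<psi> has_derivative (\<lambda>h. \<beta> * (\<theta> \<bullet> h) * cos (\<theta> \<bullet> x) - \<alpha> * (\<theta> \<bullet> h) * sin (\<theta> \<bullet> x))) (at x)" for x
      by (auto intro!: derivative_eq_intros simp: fun_eq_iff algebra_simps)
    then have "frechet_derivative ?\<psi> (at x) (axis j 1) = \<beta> * c * cos (\<theta> \<bullet> x) - \<alpha> * c * sin (\<theta> \<bullet> x)" for x
      unfolding \<theta>j[symmetric] by (rule fun_cong[OF frechet_derivative_at, symmetric])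
    moreover have "(LINT x|torus L. v x $ i * frechet_derivative ?\<psi> (at x) (axis j 1)) = - (LINT x|torus L. G x $ i $ j * ?\<psi> x)"
      using G smooth_on_trig[of \<alpha> \<theta> \<beta>] per unfolding has_weak_grad_def by blast
    ultimately show ?thesis by simp
  qed
  have vcs: "(LINT x|torus L. v x $ i * (a * cos (\<theta> \<bullet> x) - b * sin (\<theta> \<bullet> x))) = a * Vc - b * Vs" for a b
  proof -
    have e: "v x $ i * (a * cos (\<theta> \<bullet> x) - b * sin (\<theta> \<bullet> x)) = a * (v x $ i * cos (\<theta> \<bullet> x)) - b * (v x $ i * sin (\<theta> \<bullet> x))" for x
      by (simp add: algebra_simps)
    show ?thesis unfolding e Vc_def Vs_def
      using prod_int[OF vi ci(1)] prod_int[OF vi ci(2)] by simp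
  qed
  have "Gc = c * Vs" using weak[of 1 0] vcs[of 0 c] by (simp add: Gc_def)
  moreover have "Gs = - c * Vc" using weak[of 0 1] vcs[of c 0] by (simp add: Gs_def)
  ultimately show ?thesis
    unfolding split[OF vi] split[OF Gi]
    by (simp add: Vc_def[symmetric] Vs_def[symmetric] Gc_def[symmetric] Gs_def[symmetric] complex_eq_iff) (simp add: c_def)
qed

section \<open>Shell energies controlled by the gradient\<close>

lemma fourier_coeff_component:
  "fourier_coeff L v k $ i = (LINT x|torus L. of_real (v x $ i) * character L (- k) x) / of_real (L ^ 3)"
  by (simp add: fourier_coeff_def character_def int_vec_uminus)

text \<open>Removes the zero frequency, the one mode of the block q = -1 that a gradient cannot
  control.\<close>

lemma fourier_coeff_0:
  assumes "v \<in> L2_torus L" and "zero_mean L v"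
  shows "fourier_coeff L v 0 = 0"
proof -
  have "(LINT x|torus L. complex_of_real (v x $ i)) = 0" for i
  proof -
    have "(LINT x|torus L. complex_of_real (v x $ i)) = of_real (LINT x|torus L. v x $ i)"
      by (rule integral_complex_of_real)
    also have "(LINT x|torus L. v x $ i) = (LINT x|torus L. v x) $ i"
      using L2_torus_integrable[OF assms(1)] by (intro integral_bounded_linear[OF bounded_linear_vec_nth])
    finally show ?thesis using assms(2) by (simp add: zero_mean_def)
  qed
  then show ?thesis by (simp add: vec_eq_iff fourier_coeff_component)
qed

text \<open>Bessel's inequality for each entry of the gradient. Passing to normalised coefficients,
  the Fourier integrals square to 4 pi^2 L^4 |k|^2 |c_k|^2 in total, and dividing by the factor L^3
  from Bessel leaves L.\<close>

lemma fourier_coeff_grad_bound: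
  assumes L: "0 < L" and v: "v \<in> L2_torus L" and G: "has_weak_grad L v G" and F: "finite F"
  shows "4 * pi\<^sup>2 * L * (\<Sum>k\<in>F. (norm (int_vec k))\<^sup>2 * (norm (fourier_coeff L v k))\<^sup>2)
    \<le> (LINT x|torus L. (norm (G x))\<^sup>2)"
proof -
  let ?G = "\<lambda>i j k. LINT x|torus L. of_real (G x $ i $ j) * character L (- k) x"
  have G2: "G \<in> L2_torus L" using G by (simp add: has_weak_grad_def)
  have comp: "integrable (torus L) (\<lambda>x. complex_of_real (G x $ i $ j))"
       "integrable (torus L) (\<lambda>x. (norm (complex_of_real (G x $ i $ j)))\<^sup>2)" for i j
  proof -
    have int: "integrable (torus L) (\<lambda>x. G x $ i $ j)"
      using L2_torus_integrable[OF G2]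
      by (intro integrable_bounded_linear[OF bounded_linear_vec_nth[of j]] integrable_bounded_linear[OF bounded_linear_vec_nth[of i]])
    then show "integrable (torus L) (\<lambda>x. complex_of_real (G x $ i $ j))"
      by simp
    have "integrable (torus L) (\<lambda>x. (norm (G x))\<^sup>2)" using G2 by (simp add: L2_torus_def)
    then show "integrable (torus L) (\<lambda>x. (norm (complex_of_real (G x $ i $ j)))\<^sup>2)"
    proof (rule Bochner_Integration.integrable_bound)
      have "norm (G x $ i $ j) \<le> norm (G x)" for x
        by (meson Finite_Cartesian_Product.norm_nth_le order_trans)
      then show "AE x in torus L. norm ((norm (complex_of_real (G x $ i $ j)))\<^sup>2) \<le> norm ((norm (G x))\<^sup>2)"
        by (auto intro!: AE_I2 simp: abs_le_square_iff[symmetric])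
      show "(\<lambda>x. (norm (complex_of_real (G x $ i $ j)))\<^sup>2) \<in> borel_measurable (torus L)"
        using int by (intro borel_measurable_power borel_measurable_norm) auto
    qed
  qed
  have norm_G: "(norm (G x))\<^sup>2 = (\<Sum>i\<in>UNIV. \<Sum>j\<in>UNIV. (norm (complex_of_real (G x $ i $ j)))\<^sup>2)" for x
    by (simp add: norm_sq_components)
  have k: "(\<Sum>i\<in>UNIV. \<Sum>j\<in>UNIV. (norm (?G i j k))\<^sup>2) = 4 * pi\<^sup>2 * L ^ 4 * ((norm (int_vec k))\<^sup>2 * (norm (fourier_coeff L v k))\<^sup>2)" for k
  proof -
    have "(norm (?G i j k))\<^sup>2 = 4 * pi\<^sup>2 * L ^ 4 * ((norm (int_vec k $ j))\<^sup>2 * (norm (fourier_coeff L v k $ i))\<^sup>2)" for i j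
      unfolding fourier_weak_grad[OF L v G] fourier_coeff_component
      using L by (simp add: norm_mult norm_divide norm_power power_mult_distrib power_divide int_vec_def eval_nat_numeral)
    then show ?thesis
      unfolding norm_sq_components[of "int_vec k"] norm_sq_components[of "fourier_coeff L v k"]
      by (subst sum.swap) (simp only: sum_product, simp only: sum_distrib_left)
  qed
  have "4 * pi\<^sup>2 * L ^ 4 * (\<Sum>k\<in>F. (norm (int_vec k))\<^sup>2 * (norm (fourier_coeff L v k))\<^sup>2)
      = (\<Sum>k\<in>F. \<Sum>i\<in>UNIV. \<Sum>j\<in>UNIV. (norm (?G i j k))\<^sup>2)"
    by (simp only: k sum_distrib_left)
  also have "\<dots> = (\<Sum>i\<in>UNIV. \<Sum>j\<in>UNIV. \<Sum>k\<in>F. (norm (?G i j k))\<^sup>2)"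
    by (subst sum.swap, intro sum.cong refl, subst sum.swap, rule refl)
  also have "\<dots> \<le> (\<Sum>i\<in>UNIV. \<Sum>j\<in>UNIV. L ^ 3 * (LINT x|torus L. (norm (complex_of_real (G x $ i $ j)))\<^sup>2))"
    by (intro sum_mono bessel_inequality[OF L F] comp)
  also have "\<dots> = L ^ 3 * (LINT x|torus L. (norm (G x))\<^sup>2)"
    unfolding norm_G using comp
    by (subst Bochner_Integration.integral_sum; (intro Bochner_Integration.integrable_sum)?; (simp only: Bochner_Integration.integral_sum sum_distrib_left)?)
  finally show ?thesis
    using L by (simp add: eval_nat_numeral field_simps)
qed

text \<open>Parseval over a frequency set \<open>U\<close> that may exceed the ball: several shells
  can then share one set, so that the sums over shells and frequencies can be exchanged.\<close>

lemma LP_proj_L2: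
  assumes chi: "LP_cutoff chi" and L: "0 < L" and q: "-1 \<le> q" and U: "finite U" "freq_ball q \<subseteq> U"
  shows "(Lp_norm L 2 (LP_proj chi L q v))\<^sup>2
    = L ^ 3 * (\<Sum>k\<in>U. (LP_symbol chi q (int_vec k))\<^sup>2 * (norm (fourier_coeff L v k))\<^sup>2)"
proof -
  let ?a = "\<lambda>i k. of_real (LP_symbol chi q (int_vec k)) * fourier_coeff L v k $ i"
  have fin: "finite (freq_ball q)" using q by (rule finite_card_freq_ball)
  have "(Lp_norm L 2 (LP_proj chi L q v))\<^sup>2 = (LINT x|torus L. (\<Sum>i\<in>UNIV. (norm (trig_poly L (freq_ball q) (?a i) x))\<^sup>2))"
    unfolding Lp_norm_2_sq norm_sq_components LP_proj_component[OF chi q] ..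
  also have "\<dots> = (\<Sum>i\<in>UNIV. L ^ 3 * (\<Sum>k\<in>freq_ball q. (norm (?a i k))\<^sup>2))"
    by (subst Bochner_Integration.integral_sum)
       (auto simp: parseval_trig_poly[OF L fin] intro!: continuous_integrable_torus continuous_intros)
  also have "\<dots> = L ^ 3 * (\<Sum>k\<in>freq_ball q. \<Sum>i\<in>UNIV. (norm (?a i k))\<^sup>2)"
    by (subst sum.swap) (simp only: sum_distrib_left)
  also have "\<dots> = L ^ 3 * (\<Sum>k\<in>freq_ball q. (LP_symbol chi q (int_vec k))\<^sup>2 * (norm (fourier_coeff L v k))\<^sup>2)"
    by (simp add: norm_mult power_mult_distrib norm_sq_components[of "fourier_coeff L v _"] sum_distrib_left)
  also have "(\<Sum>k\<in>freq_ball q. (LP_symbol chi q (int_vec k))\<^sup>2 * (norm (fourier_coeff L v k))\<^sup>2)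
      = (\<Sum>k\<in>U. (LP_symbol chi q (int_vec k))\<^sup>2 * (norm (fourier_coeff L v k))\<^sup>2)"
  proof (rule sum.mono_neutral_left[OF U])
    show "\<forall>k\<in>U - freq_ball q. (LP_symbol chi q (int_vec k))\<^sup>2 * (norm (fourier_coeff L v k))\<^sup>2 = 0"
      by (auto simp: freq_ball_def LP_symbol_eq_0_high[OF chi q])
  qed
  finally show ?thesis .
qed

text \<open>Shells with 3/4 * 2^q >= |k| do not see \<open>k\<close>, so the sum of 4^q over the
  remaining ones is geometric and comparable to its largest term. The constant is 4/3 * (4/3)^2 =
  64/27 <= 3.\<close>

lemma sum_freq_sq_LP_symbol_le:
  assumes chi: "LP_cutoff chi" and M: "\<And>\<xi>. chi \<xi> \<le> M" and L: "0 < L"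
    and A: "finite A" "A \<subseteq> {-1..}" and k: "k \<noteq> 0"
  shows "(\<Sum>q\<in>A. (LP_freq L q)\<^sup>2 * (LP_symbol chi q (int_vec k))\<^sup>2) \<le> 3 * M\<^sup>2 / L\<^sup>2 * (norm (int_vec k))\<^sup>2"
proof -
  let ?n = "norm (int_vec k)"
  define B where "B = {q \<in> A. LP_symbol chi q (int_vec k) \<noteq> 0}"
  have finB: "finite B" using A by (simp add: B_def)
  have B: "2 powi q \<le> 4/3 * ?n" if "q \<in> B" for q
  proof -
    have q: "-1 \<le> q" "LP_symbol chi q (int_vec k) \<noteq> 0" using that A by (auto simp: B_def)
    \<comment> \<open>A nonzero integer frequency has norm at least 1, where the block q = -1
      vanishes; the lower support bound then applies with q >= 0.\<close>
    have "q \<noteq> -1"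
      using LP_symbol_eq_0_high[OF chi q(1), of "int_vec k"] q(2) norm_int_vec_ge_1[OF k] by auto
    then have "0 \<le> q" using q(1) by simp
    then have "\<not> ?n \<le> 3/4 * 2 powi q" using LP_symbol_eq_0_low[OF chi] q(2) by blast
    then show ?thesis by simp
  qed
  have "(\<Sum>q\<in>A. (LP_freq L q)\<^sup>2 * (LP_symbol chi q (int_vec k))\<^sup>2)
      = (\<Sum>q\<in>B. (LP_freq L q)\<^sup>2 * (LP_symbol chi q (int_vec k))\<^sup>2)"
    using A by (intro sum.mono_neutral_right) (auto simp: B_def)
  also have "\<dots> \<le> (\<Sum>q\<in>B. M\<^sup>2 / L\<^sup>2 * 4 powi q)"
  proof (rule sum_mono)
    fix q
    have "\<bar>LP_symbol chi q (int_vec k)\<bar>\<^sup>2 \<le> M\<^sup>2"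
      by (intro power_mono abs_LP_symbol_le[OF chi M]) simp
    moreover have "(LP_freq L q)\<^sup>2 = 4 powi q / L\<^sup>2"
      using power_int_mult_distrib[of "2::real" 2 q] by (simp add: LP_freq_def power_divide power2_eq_square)
    ultimately have "(LP_freq L q)\<^sup>2 * (LP_symbol chi q (int_vec k))\<^sup>2 \<le> (4 powi q / L\<^sup>2) * M\<^sup>2"
      by (metis mult_left_mono power2_abs zero_le_power2)
    then show "(LP_freq L q)\<^sup>2 * (LP_symbol chi q (int_vec k))\<^sup>2 \<le> M\<^sup>2 / L\<^sup>2 * 4 powi q"
      by (simp add: mult_ac)
  qed
  also have "\<dots> = M\<^sup>2 / L\<^sup>2 * (\<Sum>q\<in>B. 4 powi q)"
    by (simp add: sum_distrib_left)
  also have "\<dots> \<le> M\<^sup>2 / L\<^sup>2 * (3 * ?n\<^sup>2)"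
  proof (rule mult_left_mono)
    show "(\<Sum>q\<in>B. 4 powi q) \<le> 3 * ?n\<^sup>2"
    proof (cases "B = {}")
      case False
      have "(\<Sum>q\<in>B. (4::real) powi q) \<le> 4 / (4 - 1) * 4 powi (Max B)"
        using finB by (intro sum_powi_le) auto
      also have "(4::real) powi (Max B) = (2 powi (Max B))\<^sup>2"
        using power_int_mult_distrib[of "2::real" 2 "Max B"] by (simp add: power2_eq_square)
      also have "\<dots> \<le> (4/3 * ?n)\<^sup>2"
        using B[OF Max_in[OF finB False]] by (intro power_mono) auto
      finally have "(\<Sum>q\<in>B. (4::real) powi q) \<le> 64/27 * ?n\<^sup>2"
        by (simp add: power_mult_distrib power_divide)
      also have "\<dots> \<le> 3 * ?n\<^sup>2" by (intro mult_right_mono) auto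
      finally show ?thesis .
    qed simp
  qed simp
  finally show ?thesis by (simp add: mult_ac)
qed

lemma LP_sum_le_grad:
  assumes chi: "LP_cutoff chi" and M: "\<And>\<xi>. chi \<xi> \<le> M" and L: "0 < L"
    and v: "v \<in> L2_torus L" "zero_mean L v" and G: "has_weak_grad L v G"
    and A: "finite A" "A \<subseteq> {-1..}"
  shows "(\<Sum>q\<in>A. (LP_freq L q)\<^sup>2 * (Lp_norm L 2 (LP_proj chi L q v))\<^sup>2) \<le> M\<^sup>2 * (Lp_norm L 2 G)\<^sup>2"
proof -
  define U where "U = (\<Union>q\<in>A. freq_ball q)"
  have U: "finite U" using A finite_card_freq_ball(1) by (auto simp: U_def)
  let ?c = "\<lambda>k. (norm (fourier_coeff L v k))\<^sup>2"
  have "(\<Sum>q\<in>A. (LP_freq L q)\<^sup>2 * (Lp_norm L 2 (LP_proj chi L q v))\<^sup>2)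
      = (\<Sum>q\<in>A. (LP_freq L q)\<^sup>2 * (L ^ 3 * (\<Sum>k\<in>U. (LP_symbol chi q (int_vec k))\<^sup>2 * ?c k)))"
    using A(2) by (intro sum.cong refl arg_cong2[where f = "(*)"] LP_proj_L2[OF chi L _ U]) (auto simp: U_def)
  also have "\<dots> = (\<Sum>k\<in>U. L ^ 3 * ?c k * (\<Sum>q\<in>A. (LP_freq L q)\<^sup>2 * (LP_symbol chi q (int_vec k))\<^sup>2))"
    unfolding sum_distrib_left by (subst sum.swap) (simp add: mult_ac)
  also have "\<dots> \<le> (\<Sum>k\<in>U. L ^ 3 * ?c k * (3 * M\<^sup>2 / L\<^sup>2 * (norm (int_vec k))\<^sup>2))"
  proof (rule sum_mono)
    fix k
    show "L ^ 3 * ?c k * (\<Sum>q\<in>A. (LP_freq L q)\<^sup>2 * (LP_symbol chi q (int_vec k))\<^sup>2)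
        \<le> L ^ 3 * ?c k * (3 * M\<^sup>2 / L\<^sup>2 * (norm (int_vec k))\<^sup>2)"
    proof (cases "k = 0")
      case True
      then show ?thesis by (simp add: fourier_coeff_0[OF v])
    next
      case False
      then show ?thesis
        using L by (intro mult_left_mono sum_freq_sq_LP_symbol_le[OF chi M L A]) auto
    qed
  qed
  also have "\<dots> = 3 * M\<^sup>2 * (L * (\<Sum>k\<in>U. (norm (int_vec k))\<^sup>2 * ?c k))"
    using L by (simp add: sum_distrib_left eval_nat_numeral mult_ac)
  \<comment> \<open>The factor 3 is absorbed by the 4 pi^2 of
    \<open>fourier_coeff_grad_bound\<close>, as 4 pi^2 / 3 >= 1.\<close>
  also have "\<dots> \<le> 3 * M\<^sup>2 * (L * (\<Sum>k\<in>U. (norm (int_vec k))\<^sup>2 * ?c k)) * (4 * pi\<^sup>2 / 3)"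
  proof -
    have "1 * 1 \<le> pi * pi" using pi_gt3 by (intro mult_mono) auto
    then have "1 \<le> 4 * pi\<^sup>2 / 3" by (simp add: power2_eq_square)
    moreover have "0 \<le> 3 * M\<^sup>2 * (L * (\<Sum>k\<in>U. (norm (int_vec k))\<^sup>2 * ?c k))"
      using L by (auto intro!: mult_nonneg_nonneg sum_nonneg)
    moreover have "y \<le> y * z" if "1 \<le> z" "0 \<le> y" for y z :: real
      using mult_left_mono[OF that] by simp
    ultimately show ?thesis by blast
  qed
  also have "\<dots> = M\<^sup>2 * (4 * pi\<^sup>2 * L * (\<Sum>k\<in>U. (norm (int_vec k))\<^sup>2 * ?c k))"
    by simp
  also have "\<dots> \<le> M\<^sup>2 * (LINT x|torus L. (norm (G x))\<^sup>2)"
    by (intro mult_left_mono fourier_coeff_grad_bound[OF L v(1) G U]) simp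
  finally show ?thesis by (simp add: Lp_norm_2_sq)
qed

section \<open>Sums over a possibly infinite range of shells\<close>

lemma infsum_ennreal_le:
  assumes "\<And>F. finite F \<Longrightarrow> F \<subseteq> A \<Longrightarrow> sum f F \<le> y" and "\<And>x. x \<in> A \<Longrightarrow> 0 \<le> f x"
  shows "(\<Sum>\<^sub>\<infinity>x\<in>A. ennreal (f x)) \<le> ennreal y"
  unfolding nonneg_infsum_complete[of A "\<lambda>x. ennreal (f x)", OF zero_le]
proof (rule SUP_least)
  fix F assume F: "F \<in> {F. finite F \<and> F \<subseteq> A}"
  then have "(\<Sum>x\<in>F. ennreal (f x)) = ennreal (sum f F)"
    using assms(2) by (intro sum_ennreal) auto
  also have "\<dots> \<le> ennreal y"
    using F assms(1) by (intro ennreal_leI) auto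
  finally show "(\<Sum>x\<in>F. ennreal (f x)) \<le> ennreal y" .
qed

lemma finite_sum_le_infsum_ennreal:
  assumes "finite F" and "F \<subseteq> A" and "\<And>x. x \<in> A \<Longrightarrow> 0 \<le> f x"
  shows "ennreal (sum f F) \<le> (\<Sum>\<^sub>\<infinity>x\<in>A. ennreal (f x))"
proof -
  have "ennreal (sum f F) = (\<Sum>x\<in>F. ennreal (f x))"
    using assms by (intro sum_ennreal[symmetric]) auto
  also have "\<dots> \<le> (\<Sum>\<^sub>\<infinity>x\<in>A. ennreal (f x))"
    unfolding nonneg_infsum_complete[of A "\<lambda>x. ennreal (f x)", OF zero_le]
    using assms by (intro SUP_upper) auto
  finally show ?thesis .
qed

section \<open>Unresolved scales\<close>

lemma LP_freq_pos: "0 < L \<Longrightarrow> 0 < LP_freq L q"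
  by (simp add: LP_freq_def)

lemma LP_freq_mono: "0 < L \<Longrightarrow> p \<le> q \<Longrightarrow> LP_freq L p \<le> LP_freq L q"
  by (simp add: LP_freq_def divide_right_mono power_int_increasing)

lemma LP_freq_inject: "0 < L \<Longrightarrow> LP_freq L p = LP_freq L q \<longleftrightarrow> p = q"
  by (metis LP_freq_def divide_cancel_right less_irrefl linorder_neqE power_int_strict_increasing one_less_numeral_iff semiring_norm(76))

lemma Lp_norm_nonneg: "0 \<le> Lp_norm L p v"
  by (simp add: Lp_norm_def)

text \<open>Squaring the hypothesis gives the exponent -2 + 6/r; multiplying by x^(1+D) turns it
  into -1 + 6/r + D, the weight of the intermittency condition.\<close>

lemma high_mode_bound:
  fixes x N \<gamma> r D :: real
  assumes "0 < x" and "0 \<le> \<gamma>" and "\<gamma> \<le> x powr (-1 + 3 / r) * N"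
  shows "\<gamma>\<^sup>2 * x powr (1 + D) \<le> x powr (-1 + 6 / r + D) * N\<^sup>2"
proof -
  have "\<gamma>\<^sup>2 \<le> (x powr (-1 + 3 / r) * N)\<^sup>2"
    using assms by (intro power_mono)
  also have "\<dots> = x powr (-2 + 6 / r) * N\<^sup>2"
    by (simp add: power_mult_distrib power2_eq_square flip: powr_add)
  finally have "\<gamma>\<^sup>2 * x powr (1 + D) \<le> x powr (-2 + 6 / r) * N\<^sup>2 * x powr (1 + D)"
    by (rule mult_right_mono) simp
  also have "\<dots> = x powr (-1 + 6 / r + D) * N\<^sup>2"
    by (simp add: mult_ac flip: powr_add) (simp add: algebra_simps)
  finally show ?thesis .
qed

text \<open>The natural constant x/(x-1) with x = 2^s decreases in s, so it may be evaluated at the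
  lower bound eta. This keeps it independent of d, through which s varies.\<close>

lemma sum_LP_freq_powr_le:
  assumes L: "0 < L" and \<eta>: "0 < \<eta>" "\<eta> \<le> s"
  shows "(\<Sum>p = -1..q. LP_freq L p powr s) \<le> 2 powr \<eta> / (2 powr \<eta> - 1) * LP_freq L q powr s"
proof -
  define x y where "x = (2::real) powr s" and "y = (2::real) powr \<eta>"
  have y: "1 < y" "y \<le> x" using \<eta> by (auto simp: x_def y_def)
  have e: "LP_freq L p powr s = x powi p * L powr (- s)" for p
  proof -
    have "(2 powi p) powr s = x powi p"
      by (simp add: x_def powr_real_of_int'[symmetric] powr_powr mult.commute)
    then show ?thesis using L by (simp add: LP_freq_def powr_divide powr_minus_divide)
  qed
  have "(\<Sum>p = -1..q. LP_freq L p powr s) = (\<Sum>p = -1..q. x powi p) * L powr (- s)"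
    by (simp add: e sum_distrib_right)
  also have "\<dots> \<le> x / (x - 1) * x powi q * L powr (- s)"
    using y by (intro mult_right_mono sum_powi_le) auto
  also have "\<dots> \<le> y / (y - 1) * x powi q * L powr (- s)"
    using y by (intro mult_right_mono) (auto simp: field_simps)
  finally show ?thesis by (simp add: e y_def mult.assoc)
qed

text \<open>Cauchy-Schwarz with the weight 3/r split as (-1 + 6/r + D)/2 + (1 - D)/2: the first part
  reproduces the intermittency weight after squaring, the second leaves a geometric sum of order
  lambda_q^(1-D). Against the prefactor lambda_q^(-2) this gives lambda_q^(-1-D).\<close>

lemma low_mode_bound:
  fixes N :: "int \<Rightarrow> real"
  assumes L: "0 < L" and \<gamma>: "0 \<le> \<gamma>" and D: "0 \<le> D" "\<eta> \<le> 1 - D" "0 < \<eta>" and b: "0 \<le> b"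
    and N: "\<And>p. 0 \<le> N p"
    and low: "\<gamma> \<le> LP_freq L q powr (-1) * (b * (\<Sum>p = -1..q. LP_freq L p powr (3 / r) * N p))"
  shows "\<gamma>\<^sup>2 * LP_freq L (q + 1) powr (1 + D)
    \<le> 4 * b\<^sup>2 * (2 powr \<eta> / (2 powr \<eta> - 1)) * (\<Sum>p = -1..q. LP_freq L p powr (-1 + 6 / r + D) * (N p)\<^sup>2)"
proof -
  let ?l = "LP_freq L"
  define g where "g = 2 powr \<eta> / (2 powr \<eta> - 1)"
  define S where "S = (\<Sum>p = -1..q. ?l p powr (-1 + 6 / r + D) * (N p)\<^sup>2)"
  have g0: "0 \<le> g" using D by (auto simp: g_def intro!: divide_nonneg_nonneg ge_one_powr_ge_zero)
  have S0: "0 \<le> S" unfolding S_def by (intro sum_nonneg) auto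
  have pos: "0 < ?l p" for p using L by (rule LP_freq_pos)
  have "(\<Sum>p = -1..q. ?l p powr (3 / r) * N p)
      = (\<Sum>p = -1..q. (?l p powr ((-1 + 6 / r + D) / 2) * N p) * ?l p powr ((1 - D) / 2))"
    by (intro sum.cong refl) (simp add: mult_ac flip: powr_add, simp add: field_simps)
  then have "(\<Sum>p = -1..q. ?l p powr (3 / r) * N p)\<^sup>2
      = (\<Sum>p = -1..q. (?l p powr ((-1 + 6 / r + D) / 2) * N p) * ?l p powr ((1 - D) / 2))\<^sup>2"
    by (rule arg_cong)
  also have "\<dots> \<le> (\<Sum>p = -1..q. (?l p powr ((-1 + 6 / r + D) / 2) * N p)\<^sup>2) * (\<Sum>p = -1..q. (?l p powr ((1 - D) / 2))\<^sup>2)"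
    by (rule Cauchy_Schwarz_ineq_sum)
  also have "\<dots> = S * (\<Sum>p = -1..q. ?l p powr (1 - D))"
  proof -
    have "(y powr (s / 2))\<^sup>2 = y powr s" for y s :: real
      by (simp add: power2_eq_square flip: powr_add)
    then show ?thesis by (simp add: S_def power_mult_distrib)
  qed
  also have "\<dots> \<le> S * (g * ?l q powr (1 - D))"
    using S0 D unfolding g_def by (intro mult_left_mono sum_LP_freq_powr_le[OF L])
  finally have CS: "(\<Sum>p = -1..q. ?l p powr (3 / r) * N p)\<^sup>2 \<le> S * (g * ?l q powr (1 - D))" .
  have "\<gamma>\<^sup>2 \<le> (?l q powr (-1) * (b * (\<Sum>p = -1..q. ?l p powr (3 / r) * N p)))\<^sup>2"
    using \<gamma> low by (intro power_mono)
  also have "\<dots> = ?l q powr (-2) * b\<^sup>2 * (\<Sum>p = -1..q. ?l p powr (3 / r) * N p)\<^sup>2"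
  proof -
    have "(?l q powr (-1))\<^sup>2 = ?l q powr (-2)"
      unfolding power2_eq_square powr_add[symmetric] by simp
    then show ?thesis by (simp only: power_mult_distrib mult.assoc)
  qed
  also have "\<dots> \<le> ?l q powr (-2) * b\<^sup>2 * (S * (g * ?l q powr (1 - D)))"
    by (intro mult_left_mono CS) auto
  also have "\<dots> = b\<^sup>2 * g * S * ?l q powr (- 1 - D)"
    by (simp add: mult_ac flip: powr_add)
  finally have 1: "\<gamma>\<^sup>2 \<le> b\<^sup>2 * g * S * ?l q powr (- 1 - D)" .
  \<comment> \<open>Moving from scale q to q + 1 costs 2^(1+D), at most 4 since D < 1.\<close>
  have "?l (q + 1) powr (1 + D) = 2 powr (1 + D) * ?l q powr (1 + D)"
    using L by (simp add: LP_freq_def power_int_add powr_mult powr_divide)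
  also have "\<dots> \<le> 2 powr 2 * ?l q powr (1 + D)"
    using D by (intro mult_right_mono powr_mono) auto
  finally have 2: "?l (q + 1) powr (1 + D) \<le> 4 * ?l q powr (1 + D)" by simp
  have "\<gamma>\<^sup>2 * ?l (q + 1) powr (1 + D) \<le> (b\<^sup>2 * g * S * ?l q powr (- 1 - D)) * (4 * ?l q powr (1 + D))"
    using g0 S0 by (intro mult_mono 1 2) auto
  also have "\<dots> = 4 * b\<^sup>2 * g * S * (?l q powr (- 1 - D) * ?l q powr (1 + D))"
    by simp
  also have "?l q powr (- 1 - D) * ?l q powr (1 + D) = 1"
    using pos[of q] by (simp flip: powr_add)
  finally show ?thesis by (simp add: S_def g_def)
qed

section \<open>Scales that fail the conditions defining the wavenumber\<close>

definition resolved ::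
  "(real^3 \<Rightarrow> real) \<Rightarrow> real \<Rightarrow> real \<Rightarrow> real \<Rightarrow> real \<Rightarrow> (real^3 \<Rightarrow> real^3) \<Rightarrow> nat \<Rightarrow> bool" where
  "resolved chi L \<nu> r c v q \<longleftrightarrow>
     (\<forall>p > int q. LP_freq L p powr (-1 + 3 / r) * Lp_norm L r (LP_proj chi L p v) < c * \<nu>) \<and>
     LP_freq L (int q) powr (-1) * Linf_norm L (LP_low chi L (int q) v) < c * \<nu>"

lemma determining_wavenumber_resolved:
  "determining_wavenumber chi L \<nu> r c v = Inf {ennreal (LP_freq L (int q)) | q. resolved chi L \<nu> r c v q}"
  by (simp add: determining_wavenumber_def resolved_def)

text \<open>Frequencies increase with the scale, so the infimum is attained at the least resolved
  scale; injectivity of \<open>LP_freq\<close> identifies that scale with \<open>n\<close>.\<close>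

lemma determining_wavenumber_enatD:
  assumes L: "0 < L" and dw: "determining_wavenumber chi L \<nu> r c v = LP_freq_enat L (enat n)"
  shows "resolved chi L \<nu> r c v n" and "m < n \<Longrightarrow> \<not> resolved chi L \<nu> r c v m"
proof -
  let ?R = "resolved chi L \<nu> r c v"
  have ex: "\<exists>q. ?R q"
  proof (rule ccontr)
    assume "\<nexists>q. ?R q"
    then have "determining_wavenumber chi L \<nu> r c v = \<infinity>"
      by (simp add: determining_wavenumber_resolved)
    then show False using dw by (simp add: LP_freq_enat_def)
  qed
  have least: "?R (LEAST q. ?R q)" using ex by (rule LeastI_ex)
  have "Inf {ennreal (LP_freq L (int q)) | q. ?R q} = ennreal (LP_freq L (int (LEAST q. ?R q)))"
    using least by (intro Inf_eqI) (auto intro!: ennreal_leI LP_freq_mono[OF L] Least_le)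
  then have "ennreal (LP_freq L (int (LEAST q. ?R q))) = ennreal (LP_freq L (int n))"
    using dw by (simp add: determining_wavenumber_resolved LP_freq_enat_def)
  then have n: "(LEAST q. ?R q) = n"
    using L LP_freq_pos[OF L, of "int n"] LP_freq_pos[OF L, of "int (LEAST q. ?R q)"]
    by (simp add: LP_freq_inject)
  show "?R n" using least n by simp
  show "\<not> ?R m" if "m < n" using not_less_Least n that by metis
qed

lemma determining_wavenumber_infinityD:
  assumes "determining_wavenumber chi L \<nu> r c v = LP_freq_enat L \<infinity>"
  shows "\<not> resolved chi L \<nu> r c v m"
proof
  assume "resolved chi L \<nu> r c v m"
  then have "determining_wavenumber chi L \<nu> r c v \<le> ennreal (LP_freq L (int m))"
    unfolding determining_wavenumber_resolved by (intro Inf_lower) auto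
  then show False using assms by (simp add: LP_freq_enat_def top_unique)
qed

text \<open>The summand 1 serves the case of one large shell; the other is the constant of
  \<open>low_mode_bound\<close> with b the Bernstein constant and eta = 6/r - 2 = 1 - (3 - 6/r), the
  least value of 1 - D for d in [0,3].\<close>

definition unresolved_const :: "real \<Rightarrow> real" where
  "unresolved_const r = 1 + 4 * (3 * 1728 powr (1 / r))\<^sup>2 * (2 powr (6 / r - 2) / (2 powr (6 / r - 2) - 1))"

lemma unresolved_const_ge_1: "2 < r \<Longrightarrow> r < 3 \<Longrightarrow> 1 \<le> unresolved_const r"
  unfolding unresolved_const_def by (simp add: field_simps)

text \<open>The witness is {p} for one large shell p > m, and {-1..m} for a large low-frequency
  part. The containment clause puts these shells inside the range summed in the intermittency
  condition: above a resolved scale n all shells are small, so a large p is at most n.\<close>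

lemma unresolved_lower_bound:
  fixes chi :: "real^3 \<Rightarrow> real" and v :: "real^3 \<Rightarrow> real^3" and L r D :: real
  defines "a \<equiv> \<lambda>q. LP_freq L q powr (-1 + 6 / r + D) * (Lp_norm L r (LP_proj chi L q v))\<^sup>2"
  assumes chi: "LP_cutoff chi" and L: "0 < L" and r: "2 < r" "r < 3" and D: "0 \<le> D" "D \<le> 3 - 6 / r"
    and c\<nu>: "0 < c * \<nu>" and nr: "\<not> resolved chi L \<nu> r c v m"
  obtains A where "finite A" and "A \<subseteq> {-1..}" and "\<And>n. resolved chi L \<nu> r c v n \<Longrightarrow> m < n \<Longrightarrow> A \<subseteq> {-1..int n}"
    and "(c * \<nu>)\<^sup>2 * LP_freq L (int m + 1) powr (1 + D) \<le> unresolved_const r * sum a A"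
proof -
  have a0: "0 \<le> a q" for q by (simp add: a_def)
  have B: "1 \<le> unresolved_const r" using r by (rule unresolved_const_ge_1)
  have "(\<exists>p>int m. c * \<nu> \<le> LP_freq L p powr (-1 + 3 / r) * Lp_norm L r (LP_proj chi L p v)) \<or>
      c * \<nu> \<le> LP_freq L (int m) powr (-1) * Linf_norm L (LP_low chi L (int m) v)"
    using nr by (auto simp: resolved_def not_less)
  then show ?thesis
  proof (elim disjE exE conjE)
    fix p assume p: "int m < p" and *: "c * \<nu> \<le> LP_freq L p powr (-1 + 3 / r) * Lp_norm L r (LP_proj chi L p v)"
    have "(c * \<nu>)\<^sup>2 * LP_freq L (int m + 1) powr (1 + D) \<le> (c * \<nu>)\<^sup>2 * LP_freq L p powr (1 + D)"
      using p L D by (intro mult_left_mono powr_mono2 LP_freq_mono) (auto intro: less_imp_le LP_freq_pos)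
    also have "\<dots> \<le> a p"
      unfolding a_def using * c\<nu> by (intro high_mode_bound LP_freq_pos L) auto
    also have "\<dots> \<le> unresolved_const r * sum a {p}"
      using mult_right_mono[OF B a0[of p]] by simp
    finally have sum_p: "(c * \<nu>)\<^sup>2 * LP_freq L (int m + 1) powr (1 + D) \<le> unresolved_const r * sum a {p}" .
    have "p \<le> int n" if "resolved chi L \<nu> r c v n" for n
      using that * unfolding resolved_def by (meson not_less)
    then show ?thesis
      using p sum_p by (intro that[of "{p}"]) auto
  next
    assume *: "c * \<nu> \<le> LP_freq L (int m) powr (-1) * Linf_norm L (LP_low chi L (int m) v)"
    also have "\<dots> \<le> LP_freq L (int m) powr (-1) *
        (3 * 1728 powr (1 / r) * (\<Sum>p = -1..int m. LP_freq L p powr (3 / r) * Lp_norm L r (LP_proj chi L p v)))"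
      using r by (intro mult_left_mono Linf_norm_LP_low_le[OF chi L]) auto
    finally have "(c * \<nu>)\<^sup>2 * LP_freq L (int m + 1) powr (1 + D)
        \<le> 4 * (3 * 1728 powr (1 / r))\<^sup>2 * (2 powr (6 / r - 2) / (2 powr (6 / r - 2) - 1)) * sum a {-1..int m}"
      unfolding a_def using c\<nu> D r by (intro low_mode_bound L Lp_norm_nonneg) (auto simp: field_simps)
    also have "\<dots> \<le> unresolved_const r * sum a {-1..int m}"
      by (intro mult_right_mono sum_nonneg a0) (simp add: unresolved_const_def)
    finally show ?thesis
      by (intro that[of "{-1..int m}"]) auto
  qed
qed

text \<open>Young's inequality in the crude form \<open>x \<le> A + A powr (- D) * x powr (1 + D)\<close> takes the place of
  Jensen's: it is pointwise, so no measurability of the wavenumber in time is needed.\<close>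

lemma determining_wavenumber_le:
  fixes v :: "real^3 \<Rightarrow> real^3" and D :: real
  assumes chi: "LP_cutoff chi" and L: "0 < L" and r: "2 < r" "r < 3" and D: "0 \<le> D" "D \<le> 3 - 6 / r"
    and c\<nu>: "0 < c * \<nu>" and A: "0 < A"
    and dw: "determining_wavenumber chi L \<nu> r c v = LP_freq_enat L Q"
  shows "determining_wavenumber chi L \<nu> r c v
    \<le> ennreal (LP_freq L 0 + A) + ennreal (A powr (- D) * unresolved_const r / (c * \<nu>)\<^sup>2) *
        (\<Sum>\<^sub>\<infinity>q\<in>LP_range Q. ennreal (LP_freq L q powr (-1 + 6 / r + D) * (Lp_norm L r (LP_proj chi L q v))\<^sup>2))"
proof -
  define a where "a q = LP_freq L q powr (-1 + 6 / r + D) * (Lp_norm L r (LP_proj chi L q v))\<^sup>2" for q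
  have a0: "0 \<le> a q" for q by (simp add: a_def)
  define S where "S = (\<Sum>\<^sub>\<infinity>q\<in>LP_range Q. ennreal (a q))"
  define K where "K = unresolved_const r / (c * \<nu>)\<^sup>2"
  have K: "0 < K" using unresolved_const_ge_1[OF r] c\<nu> unfolding K_def by (intro divide_pos_pos) auto
  define \<beta> where "\<beta> = A powr (- D) * K"
  have \<beta>: "0 < \<beta>" using A K by (simp add: \<beta>_def)
  \<comment> \<open>If x > A, then x = x^(-D) * x^(1+D) and x^(-D) <= A^(-D).\<close>
  have young: "x \<le> A + A powr (- D) * x powr (1 + D)" if "0 < x" for x
  proof (cases "x \<le> A")
    case False
    have "x = x powr (- D) * x powr (1 + D)" using that by (simp flip: powr_add)
    also have "\<dots> \<le> A powr (- D) * x powr (1 + D)"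
      using False A D by (intro mult_right_mono powr_mono2') auto
    finally show ?thesis using A by simp
  qed (simp add: add_increasing2)
  have bound: "ennreal (LP_freq L (int m + 1)) \<le> ennreal A + ennreal \<beta> * S"
    if m: "\<not> resolved chi L \<nu> r c v m" and Q: "\<And>n. Q = enat n \<Longrightarrow> resolved chi L \<nu> r c v n \<and> m < n" for m
  proof -
    let ?x = "LP_freq L (int m + 1)"
    obtain F where F: "finite F" "F \<subseteq> {-1..}" "\<And>n. resolved chi L \<nu> r c v n \<Longrightarrow> m < n \<Longrightarrow> F \<subseteq> {-1..int n}"
      "(c * \<nu>)\<^sup>2 * ?x powr (1 + D) \<le> unresolved_const r * sum a F"
      using unresolved_lower_bound[OF chi L r D c\<nu> m] unfolding a_def by blast
    have "F \<subseteq> LP_range Q" using F(2,3) Q by (cases Q) (auto simp: LP_range_def)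
    then have FS: "ennreal (sum a F) \<le> S"
      unfolding S_def by (intro finite_sum_le_infsum_ennreal F a0)
    have "?x powr (1 + D) \<le> K * sum a F"
      using F(4) zero_less_power[OF c\<nu>, of 2] by (simp add: K_def pos_le_divide_eq mult.commute)
    then have "A powr (- D) * ?x powr (1 + D) \<le> \<beta> * sum a F"
      unfolding \<beta>_def mult.assoc by (intro mult_left_mono) auto
    then have "?x \<le> A + \<beta> * sum a F" using young[OF LP_freq_pos[OF L, of "int m + 1"]] by linarith
    then have "ennreal ?x \<le> ennreal (A + \<beta> * sum a F)" by (rule ennreal_leI)
    also have "\<dots> = ennreal A + ennreal \<beta> * ennreal (sum a F)"
      using A \<beta> a0 by (simp add: ennreal_plus ennreal_mult sum_nonneg)
    also have "\<dots> \<le> ennreal A + ennreal \<beta> * S"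
      by (intro add_left_mono mult_left_mono FS) auto
    finally show ?thesis .
  qed
  have "LP_freq_enat L Q \<le> ennreal (LP_freq L 0 + A) + ennreal \<beta> * S"
  proof (cases Q)
    case (enat n)
    note dwn = determining_wavenumber_enatD[OF L dw[unfolded enat]]
    show ?thesis
    proof (cases n)
      \<comment> \<open>The wavenumber is lambda_0 here and nothing is known about the shells; this
        is the term subtracted in the theorem.\<close>
      case 0
      then show ?thesis using enat A by (auto simp: LP_freq_enat_def intro!: add_increasing2 ennreal_leI)
    next
      case (Suc m)
      have "ennreal (LP_freq L (int m + 1)) \<le> ennreal A + ennreal \<beta> * S"
        using dwn Suc enat by (intro bound) auto
      also have "\<dots> \<le> ennreal (LP_freq L 0 + A) + ennreal \<beta> * S"
        using LP_freq_pos[OF L, of 0] by (intro add_right_mono ennreal_leI) auto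
      finally show ?thesis using enat Suc by (simp add: LP_freq_enat_def add.commute)
    qed
  next
    case infinity
    have b: "ennreal (LP_freq L (int m + 1)) \<le> ennreal A + ennreal \<beta> * S" for m
      using determining_wavenumber_infinityD[OF dw[unfolded infinity]] infinity by (intro bound) auto
    \<comment> \<open>All scales fail, so the right side dominates lambda at m + 1 for every m and
      cannot be finite.\<close>
    have "ennreal A + ennreal \<beta> * S = \<infinity>"
    proof (rule ccontr)
      assume "ennreal A + ennreal \<beta> * S \<noteq> \<infinity>"
      then obtain y where y: "0 \<le> y" "ennreal A + ennreal \<beta> * S = ennreal y"
        by (metis ennreal_cases infinity_ennreal_def)
      obtain m where "y * L < 2 ^ m"
        using real_arch_pow[of 2 "y * L"] by auto
      moreover have "(2::real) ^ m < 2 * 2 ^ m" by simp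
      ultimately have "y * L < 2 * 2 ^ m" by (rule less_trans)
      then have "y < LP_freq L (int m + 1)"
        using L by (simp add: LP_freq_def power_int_add field_simps)
      then show False using b[of m] y by (simp add: ennreal_le_iff)
    qed
    then have "S = \<infinity>"
      using \<beta> by (metis ennreal_add_eq_top ennreal_mult_eq_top_iff ennreal_neq_top infinity_ennreal_def)
    then show ?thesis using \<beta> infinity by (simp add: ennreal_mult_top)
  qed
  then show ?thesis unfolding dw \<beta>_def K_def S_def a_def by simp
qed

section \<open>Measurability and averages in time\<close>

lemma L2_torus_inner_integrable:
  assumes v: "v \<in> L2_torus L" and w: "w \<in> L2_torus L"
  shows "integrable (torus L) (\<lambda>x. v x \<bullet> w x)"
proof -
  have "integrable (torus L) (\<lambda>x. (norm (v x))\<^sup>2 + (norm (w x))\<^sup>2)"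
    using v w by (auto simp: L2_torus_def)
  then show ?thesis
  proof (rule Bochner_Integration.integrable_bound)
    show "(\<lambda>x. v x \<bullet> w x) \<in> borel_measurable (torus L)"
      using v w by (auto simp: L2_torus_def intro: borel_measurable_inner)
    have "\<bar>v x \<bullet> w x\<bar> \<le> (norm (v x))\<^sup>2 + (norm (w x))\<^sup>2" for x
    proof -
      have "2 * \<bar>v x \<bullet> w x\<bar> \<le> 2 * (norm (v x) * norm (w x))" by (simp add: Cauchy_Schwarz_ineq2)
      also have "\<dots> \<le> (norm (v x))\<^sup>2 + (norm (w x))\<^sup>2" using sum_squares_bound[of "norm (v x)" "norm (w x)"] by simp
      finally show ?thesis by (smt (verit) zero_le_power2)
    qed
    then show "AE x in torus L. norm (v x \<bullet> w x) \<le> norm ((norm (v x))\<^sup>2 + (norm (w x))\<^sup>2)"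
      by simp
  qed
qed

lemma L2_norm_sq_ge_affine:
  assumes v: "v \<in> L2_torus L" and w: "w \<in> L2_torus L"
  shows "2 * inner_L2 L v w - (Lp_norm L 2 w)\<^sup>2 \<le> (Lp_norm L 2 v)\<^sup>2"
proof -
  have "0 \<le> (LINT x|torus L. (norm (v x - w x))\<^sup>2)" by simp
  also have "\<dots> = (LINT x|torus L. (norm (v x))\<^sup>2 - 2 * (v x \<bullet> w x) + (norm (w x))\<^sup>2)"
    by (simp add: power2_norm_eq_inner algebra_simps inner_commute)
  also have "\<dots> = (Lp_norm L 2 v)\<^sup>2 - 2 * inner_L2 L v w + (Lp_norm L 2 w)\<^sup>2"
    using v w L2_torus_inner_integrable[OF v w] by (simp add: L2_torus_def Lp_norm_2_sq inner_L2_def)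
  finally show ?thesis by simp
qed

text \<open>The squared norm is a supremum of functionals affine in \<open>u s\<close>, hence lower semicontinuous in time.\<close>

lemma L2_norm_sq_measurable_in_time:
  assumes wc: "weakly_continuous_L2 L T u"
  shows "(\<lambda>s. (Lp_norm L 2 (u s))\<^sup>2) \<in> borel_measurable (lebesgue_on {0..T})"
  unfolding borel_measurable_iff_le
proof
  fix y
  let ?A = "\<lambda>w. {s \<in> {0..T}. 2 * inner_L2 L (u s) w - (Lp_norm L 2 w)\<^sup>2 \<le> y}"
  have u: "u s \<in> L2_torus L" if "s \<in> {0..T}" for s using wc that by (simp add: weakly_continuous_L2_def)
  have self: "2 * inner_L2 L (u s) (u s) - (Lp_norm L 2 (u s))\<^sup>2 = (Lp_norm L 2 (u s))\<^sup>2" for s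
    by (simp add: inner_L2_def Lp_norm_2_sq power2_norm_eq_inner)
  have cl: "closed (?A w)" if "w \<in> L2_torus L" for w
  proof (rule continuous_on_closed_Collect_le)
    show "continuous_on {0..T} (\<lambda>s. 2 * inner_L2 L (u s) w - (Lp_norm L 2 w)\<^sup>2)"
      using wc that by (intro continuous_intros) (auto simp: weakly_continuous_L2_def)
  qed auto
  have eq: "{s \<in> {0..T}. (Lp_norm L 2 (u s))\<^sup>2 \<le> y} = {0..T} \<inter> (\<Inter>w\<in>L2_torus L. ?A w)"
  proof (intro set_eqI iffI)
    fix s assume s: "s \<in> {s \<in> {0..T}. (Lp_norm L 2 (u s))\<^sup>2 \<le> y}"
    then show "s \<in> {0..T} \<inter> (\<Inter>w\<in>L2_torus L. ?A w)"
      using L2_norm_sq_ge_affine[OF u[of s]] by (auto intro: order_trans)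
  next
    fix s assume s: "s \<in> {0..T} \<inter> (\<Inter>w\<in>L2_torus L. ?A w)"
    then have "s \<in> ?A (u s)" using u[of s] by blast
    then show "s \<in> {s \<in> {0..T}. (Lp_norm L 2 (u s))\<^sup>2 \<le> y}"
      unfolding mem_Collect_eq self .
  qed
  have "closed ({0..T} \<inter> (\<Inter>w\<in>L2_torus L. ?A w))"
    using cl by (intro closed_Int closed_INT) auto
  then have "{s \<in> {0..T}. (Lp_norm L 2 (u s))\<^sup>2 \<le> y} \<in> sets lebesgue"
    unfolding eq by (simp add: borel_closed)
  then show "{s \<in> space (lebesgue_on {0..T}). (Lp_norm L 2 (u s))\<^sup>2 \<le> y} \<in> sets (lebesgue_on {0..T})"
    by (auto simp: sets_restrict_space_iff)
qed

text \<open>The solution class provides integrability of the squared H^1 norm only. Subtracting the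
  measurable squared L^2 norm gives measurability of the gradient part, which the H^1 norm then
  dominates.\<close>

lemma grad_norm_sq_integrable_in_time:
  assumes wc: "weakly_continuous_L2 L T u" and H1: "L2_time_H1 L T u"
  shows "integrable (lebesgue_on {0..T}) (\<lambda>s. (Lp_norm L 2 (weak_grad L (u s)))\<^sup>2)"
proof -
  let ?h = "\<lambda>s. (H1_norm L (u s))\<^sup>2"
  have h: "?h s = (Lp_norm L 2 (u s))\<^sup>2 + (Lp_norm L 2 (weak_grad L (u s)))\<^sup>2" for s
    by (simp add: H1_norm_def)
  have int: "integrable (lebesgue_on {0..T}) ?h" using H1 by (simp add: L2_time_H1_def)
  then have "(\<lambda>s. ?h s - (Lp_norm L 2 (u s))\<^sup>2) \<in> borel_measurable (lebesgue_on {0..T})"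
    using L2_norm_sq_measurable_in_time[OF wc] by (intro borel_measurable_diff) auto
  then have "(\<lambda>s. (Lp_norm L 2 (weak_grad L (u s)))\<^sup>2) \<in> borel_measurable (lebesgue_on {0..T})"
    by (simp add: h)
  then show ?thesis
    by (rule Bochner_Integration.integrable_bound[OF int]) (simp add: h)
qed

section \<open>From the solution's own time origin to the averaging window\<close>

lemma integrable_lebesgue_on_shift:
  fixes g :: "real \<Rightarrow> real"
  assumes g: "integrable (lebesgue_on {0..b - a}) (\<lambda>s. g (a + s))" and sub: "a \<le> t" "t' \<le> b"
  shows "integrable (lebesgue_on {t..t'}) g"
proof -
  have "integrable lebesgue (\<lambda>s. indicator {0..b - a} s *\<^sub>R g (a + s))"
    using g by (simp add: integrable_restrict_space)
  then have "integrable lebesgue (\<lambda>x. indicator {0..b - a} (- a + 1 * x) *\<^sub>R g (a + (- a + 1 * x)))"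
    by (rule lebesgue_integrable_real_affine) simp
  moreover have "indicator {0..b - a} (- a + 1 * x) *\<^sub>R g (a + (- a + 1 * x)) = indicator {a..b} x *\<^sub>R g x" for x
    by (auto simp: indicator_def)
  ultimately have "set_integrable lebesgue {a..b} g"
    unfolding set_integrable_def by (simp only:)
  then have "set_integrable lebesgue {t..t'} g"
    by (rule set_integrable_subset) (use sub in auto)
  then show ?thesis
    by (simp add: set_integrable_def integrable_restrict_space)
qed

lemma AE_lebesgue_on_shift:
  fixes P :: "real \<Rightarrow> bool"
  assumes P: "AE s in lebesgue_on {0..b - a}. P (a + s)" and sub: "a \<le> t" "t' \<le> b"
  shows "AE x in lebesgue_on {t..t'}. P x"
proof -
  have "AE s in lebesgue. s \<in> {0..b - a} \<longrightarrow> P (a + s)"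
    using P by (subst (asm) AE_restrict_space_iff) auto
  then obtain N where N: "N \<in> null_sets lebesgue" "{s. \<not> (s \<in> {0..b - a} \<longrightarrow> P (a + s))} \<subseteq> N"
    unfolding eventually_ae_filter by auto
  then have "negligible ((+) a ` N)" by (simp add: negligible_iff_null_sets[symmetric] negligible_translation)
  then have "AE x in lebesgue. x \<notin> (+) a ` N"
    by (simp add: negligible_iff_null_sets AE_not_in)
  then have "AE x in lebesgue. x \<in> {t..t'} \<longrightarrow> P x"
  proof eventually_elim
    case (elim x)
    show ?case
    proof
      assume x: "x \<in> {t..t'}"
      have "x - a \<notin> N" using elim by (metis add_diff_cancel_left' add.commute diff_add_cancel image_eqI)
      then have "x - a \<in> {0..b - a} \<longrightarrow> P (a + (x - a))" using N(2) by blast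
      then show "P x" using x sub by auto
    qed
  qed
  then show ?thesis by (subst AE_restrict_space_iff) auto
qed

text \<open>A = X^(1/(1+D)) makes the two summands equal. For X = 0 this choice is not positive, and
  \<open>A\<close> is sent to 0 instead.\<close>

lemma ennreal_le_optimize_powr:
  assumes bound: "\<And>A::real. 0 < A \<Longrightarrow> e \<le> ennreal (A + A powr (- D) * X)" and X: "0 \<le> X" and D: "0 \<le> D"
  shows "e \<le> ennreal (2 * X powr (1 / (1 + D)))"
proof (cases "X = 0")
  case True
  have "e \<le> 0"
    by (rule ennreal_le_epsilon) (use bound True in simp)
  then show ?thesis using True by simp
next
  case False
  define A where "A = X powr (1 / (1 + D))"
  have A: "0 < A" using False X by (simp add: A_def)
  have "A powr (- D) * X = X powr (- D / (1 + D)) * X powr 1"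
    using False X by (simp add: A_def powr_powr)
  also have "\<dots> = X powr (- D / (1 + D) + 1)"
    by (simp only: powr_add)
  also have "- D / (1 + D) + 1 = 1 / (1 + D)" using D by (simp add: field_simps)
  finally have "A powr (- D) * X = A" by (simp add: A_def)
  with bound[OF A] show ?thesis by (simp add: A_def)
qed

section \<open>Time averages and the final estimate\<close>

lemma time_avg_mono_AE:
  assumes "AE \<tau> in lebesgue_on {t..t + T}. g \<tau> \<le> h \<tau>"
  shows "time_avg t T g \<le> time_avg t T h"
  unfolding time_avg_def by (intro mult_left_mono nn_integral_mono_AE assms) simp

lemma time_avg_affine_le:
  assumes T: "0 < T" and "0 \<le> \<alpha>" and "0 < \<beta>"
  shows "time_avg t T (\<lambda>\<tau>. ennreal \<alpha> + ennreal \<beta> * g \<tau>) \<le> ennreal \<alpha> + ennreal \<beta> * time_avg t T g"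
proof -
  have m: "emeasure (lebesgue_on {t..t + T}) {t..t + T} = ennreal T"
    using T by (simp add: emeasure_restrict_space)
  then have fin: "finite_measure (lebesgue_on {t..t + T})"
    by (intro finite_measureI) simp
  have "time_avg t T (\<lambda>\<tau>. ennreal \<alpha> + ennreal \<beta> * g \<tau>)
      \<le> ennreal (1 / T) * (ennreal \<alpha> * ennreal T + ennreal \<beta> * (\<integral>\<^sup>+\<tau>. g \<tau> \<partial>lebesgue_on {t..t + T}))"
    unfolding time_avg_def using nn_integral_affine_le[OF fin assms(2,3), of g] m
    by (intro mult_left_mono) simp_all
  also have "\<dots> = ennreal \<alpha> * (ennreal (1 / T) * ennreal T) + ennreal \<beta> * time_avg t T g"
    by (simp add: time_avg_def distrib_left mult_ac)
  also have "ennreal (1 / T) * ennreal T = 1"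
    using T by (simp flip: ennreal_mult)
  finally show ?thesis by simp
qed

lemma time_avg_ennreal:
  assumes T: "0 < T" and g: "integrable (lebesgue_on {t..t + T}) g" and "\<And>\<tau>. 0 \<le> g \<tau>"
  shows "time_avg t T (\<lambda>\<tau>. ennreal (g \<tau>)) = ennreal (1 / T * (LINT \<tau>|lebesgue_on {t..t + T}. g \<tau>))"
  unfolding time_avg_def using assms
  by (subst nn_integral_eq_integral) (auto simp flip: ennreal_mult)

text \<open>Since r (1 + D) = r + d (r - 2) and r (D - d) = -2 d, the exponent of lambda_0 is (D -
  d) / (1 + D). It converts the factor L^(-d) hidden in the dissipation rate into the lambda_0^D of
  the intermittency condition.\<close>

lemma dissipative_scaling:
  fixes L \<nu> d r D E :: real
  assumes L: "0 < L" and \<nu>: "0 < \<nu>" and r: "2 < r" and d: "0 \<le> d" and E: "0 \<le> E" and D: "D = d * (1 - 2 / r)"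
  shows "((\<nu> / L powr d * E / \<nu> ^ 3) powr (1 / (d + 1))) powr ((1 + d) / (1 + D)) * (1 / L) powr (- (2 * d) / (r + d * (r - 2)))
    = ((1 / L) powr D * E / \<nu>\<^sup>2) powr (1 / (1 + D))"
proof -
  have D0: "0 \<le> D" using r d by (simp add: D)
  have e1: "1 / (d + 1) * ((1 + d) / (1 + D)) = 1 / (1 + D)"
    using d by (simp add: field_simps)
  have "r * (1 + D) = r + d * (r - 2)" using r by (simp add: D field_simps)
  moreover have "r * (D - d) = - (2 * d)" using r by (simp add: D field_simps)
  ultimately have e2: "- (2 * d) / (r + d * (r - 2)) = (D - d) * (1 / (1 + D))"
    using r by (metis mult_divide_mult_cancel_left times_divide_eq_right mult.right_neutral less_irrefl less_trans zero_less_numeral)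
  have "(\<nu> / L powr d * E / \<nu> ^ 3) = (1 / L) powr d * E / \<nu>\<^sup>2"
    using L \<nu> by (simp add: powr_divide eval_nat_numeral)
  then have "((\<nu> / L powr d * E / \<nu> ^ 3) powr (1 / (d + 1))) powr ((1 + d) / (1 + D)) * (1 / L) powr (- (2 * d) / (r + d * (r - 2)))
      = ((1 / L) powr d * E / \<nu>\<^sup>2) powr (1 / (1 + D)) * ((1 / L) powr (D - d)) powr (1 / (1 + D))"
    by (simp only: powr_powr e1 e2)
  also have "\<dots> = ((1 / L) powr d * E / \<nu>\<^sup>2 * (1 / L) powr (D - d)) powr (1 / (1 + D))"
    by (rule powr_mult[symmetric])
  also have "(1 / L) powr d * E / \<nu>\<^sup>2 * (1 / L) powr (D - d) = ((1 / L) powr d * (1 / L) powr (D - d)) * E / \<nu>\<^sup>2"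
    by simp
  also have "(1 / L) powr d * (1 / L) powr (D - d) = (1 / L) powr D"
    by (simp flip: powr_add)
  finally show ?thesis .
qed

lemma determining_wavenumber_average_le:
  fixes chi :: "real^3 \<Rightarrow> real" and r c C0 M L \<nu> T d :: real and Q :: "real \<Rightarrow> enat"
  defines "D \<equiv> d * (1 - 2 / r)"
  assumes chi: "LP_cutoff chi" and M: "\<And>\<xi>. chi \<xi> \<le> M" and r: "2 < r" "r < 3" and c: "0 < c" and C0: "0 < C0"
    and L: "0 < L" and \<nu>: "0 < \<nu>" and T: "0 < T" and u: "leray_hopf_on L \<nu> f a b u" and ab: "a \<le> t" "t + T \<le> b"
    and dw: "\<And>\<tau>. \<tau> \<in> {t..t + T} \<Longrightarrow> determining_wavenumber chi L \<nu> r c (u \<tau>) = LP_freq_enat L (Q \<tau>)"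
    and d: "0 \<le> d" "d \<le> 3" and int: "intermittency chi L r C0 d t T Q u"
  shows "time_avg t T (\<lambda>\<tau>. determining_wavenumber chi L \<nu> r c (u \<tau>)) - ennreal (LP_freq L 0)
    \<le> ennreal (2 * max 1 (unresolved_const r * C0 * M\<^sup>2 / c\<^sup>2) *
        kolmogorov_wavenumber L \<nu> d t T u powr ((1 + d) / (1 + D)) * LP_freq L 0 powr (- (2 * d) / (r + d * (r - 2))))"
proof -
  have lh: "leray_hopf L \<nu> f (b - a) (\<lambda>s. u (a + s))" using u by (simp add: leray_hopf_on_def)
  have D: "0 \<le> D" "D \<le> 3 - 6 / r"
  proof -
    have "0 \<le> 1 - 2 / r" using r by simp
    then show "0 \<le> D" "D \<le> 3 - 6 / r"
      using d mult_right_mono[OF d(2), of "1 - 2 / r"] by (simp_all add: D_def)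
  qed
  have l0: "LP_freq L 0 = 1 / L" by (simp add: LP_freq_def)
  have l0_pos: "0 < LP_freq L 0" using L by (rule LP_freq_pos)
  have regular: "u \<tau> \<in> L2_torus L" "zero_mean L (u \<tau>)" if "\<tau> \<in> {t..t + T}" for \<tau>
  proof -
    have "\<tau> - a \<in> {0..b - a}" using that ab by auto
    then have "u (a + (\<tau> - a)) \<in> L2_torus L \<and> zero_mean L (u (a + (\<tau> - a)))"
      using lh unfolding leray_hopf_def weakly_continuous_L2_def by blast
    then show "u \<tau> \<in> L2_torus L" "zero_mean L (u \<tau>)" by simp_all
  qed
  let ?J = "lebesgue_on {t..t + T}"
  define g where "g \<tau> = (Lp_norm L 2 (weak_grad L (u \<tau>)))\<^sup>2" for \<tau>
  have g_nonneg: "0 \<le> g \<tau>" for \<tau> by (simp add: g_def)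
  have lh': "weakly_continuous_L2 L (b - a) (\<lambda>s. u (a + s))" "L2_time_H1 L (b - a) (\<lambda>s. u (a + s))"
    using lh unfolding leray_hopf_def by blast+
  have g_int: "integrable ?J g"
    using grad_norm_sq_integrable_in_time[OF lh'] unfolding g_def
    by (rule integrable_lebesgue_on_shift[where g = "\<lambda>\<tau>. (Lp_norm L 2 (weak_grad L (u \<tau>)))\<^sup>2", OF _ ab])
  have H1: "AE \<tau> in ?J. u \<tau> \<in> H1_torus L"
    using lh'(2) unfolding L2_time_H1_def
    by (intro AE_lebesgue_on_shift[where P = "\<lambda>\<tau>. u \<tau> \<in> H1_torus L", OF _ ab]) (rule conjunct1)
  define E where "E = 1 / T * (LINT \<tau>|?J. g \<tau>)"
  have E0: "0 \<le> E" using T by (simp add: E_def g_def)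
  define S where "S \<tau> = (\<Sum>\<^sub>\<infinity>q\<in>LP_range (Q \<tau>).
        ennreal (LP_freq L q powr (-1 + 6 / r + D) * (Lp_norm L r (LP_proj chi L q (u \<tau>)))\<^sup>2))" for \<tau>
  \<comment> \<open>Membership in H^1 holds only for almost every time, and only there is
    \<open>weak_grad\<close> known to be a weak gradient.\<close>
  have grad: "AE \<tau> in ?J. (\<Sum>\<^sub>\<infinity>q\<in>LP_range (Q \<tau>). ennreal ((LP_freq L q)\<^sup>2 * (Lp_norm L 2 (LP_proj chi L q (u \<tau>)))\<^sup>2))
      \<le> ennreal (M\<^sup>2 * g \<tau>)"
    using H1 AE_space
  proof eventually_elim
    case (elim \<tau>)
    then have \<tau>: "\<tau> \<in> {t..t + T}" by simp
    have "\<exists>G. has_weak_grad L (u \<tau>) G" using elim(1) by (simp add: H1_torus_def)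
    then have G: "has_weak_grad L (u \<tau>) (weak_grad L (u \<tau>))"
      unfolding weak_grad_def by (rule someI_ex)
    have "LP_range (Q \<tau>) \<subseteq> {-1..}" by (auto simp: LP_range_def split: enat.splits)
    then show ?case
      unfolding g_def
      by (intro infsum_ennreal_le LP_sum_le_grad[OF chi M L regular[OF \<tau>] G]) auto
  qed
  have "time_avg t T S \<le> ennreal (C0 * LP_freq L 0 powr D) *
      time_avg t T (\<lambda>\<tau>. \<Sum>\<^sub>\<infinity>q\<in>LP_range (Q \<tau>). ennreal ((LP_freq L q)\<^sup>2 * (Lp_norm L 2 (LP_proj chi L q (u \<tau>)))\<^sup>2))"
    using int unfolding intermittency_def S_def D_def .
  also have "\<dots> \<le> ennreal (C0 * LP_freq L 0 powr D) * time_avg t T (\<lambda>\<tau>. ennreal (M\<^sup>2 * g \<tau>))"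
    by (intro mult_left_mono time_avg_mono_AE grad) simp
  \<comment> \<open>Here the function is integrable, so the average is the ordinary integral that
    defines the dissipation rate.\<close>
  also have "time_avg t T (\<lambda>\<tau>. ennreal (M\<^sup>2 * g \<tau>)) = ennreal (M\<^sup>2 * E)"
    using T g_int by (subst time_avg_ennreal) (auto simp: E_def g_nonneg mult_ac)
  also have "ennreal (C0 * LP_freq L 0 powr D) * ennreal (M\<^sup>2 * E) = ennreal (C0 * LP_freq L 0 powr D * (M\<^sup>2 * E))"
    using C0 E0 by (simp add: ennreal_mult)
  finally have S: "time_avg t T S \<le> ennreal (C0 * LP_freq L 0 powr D * (M\<^sup>2 * E))" .
  define K where "K = unresolved_const r * C0 * M\<^sup>2 / c\<^sup>2"
  define Y where "Y = LP_freq L 0 powr D * E / \<nu>\<^sup>2"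
  have K0: "0 \<le> K" using unresolved_const_ge_1[OF r] C0 by (simp add: K_def)
  have Y0: "0 \<le> Y" using E0 by (simp add: Y_def)
  have "time_avg t T (\<lambda>\<tau>. determining_wavenumber chi L \<nu> r c (u \<tau>)) - ennreal (LP_freq L 0)
      \<le> ennreal (A + A powr (- D) * (K * Y))" if A: "0 < A" for A
  proof -
    define \<beta> where "\<beta> = A powr (- D) * unresolved_const r / (c * \<nu>)\<^sup>2"
    have \<beta>: "0 < \<beta>"
      using A c \<nu> unresolved_const_ge_1[OF r] unfolding \<beta>_def by (intro divide_pos_pos mult_pos_pos zero_less_power) auto
    have "time_avg t T (\<lambda>\<tau>. determining_wavenumber chi L \<nu> r c (u \<tau>))
        \<le> time_avg t T (\<lambda>\<tau>. ennreal (LP_freq L 0 + A) + ennreal \<beta> * S \<tau>)"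
      unfolding S_def \<beta>_def using c \<nu>
      by (intro time_avg_mono_AE AE_I2 determining_wavenumber_le[OF chi L r D _ A] dw) auto
    also have "\<dots> \<le> ennreal (LP_freq L 0 + A) + ennreal \<beta> * time_avg t T S"
      using T A l0_pos \<beta> by (intro time_avg_affine_le) auto
    also have "\<dots> \<le> ennreal (LP_freq L 0 + A) + ennreal \<beta> * ennreal (C0 * LP_freq L 0 powr D * (M\<^sup>2 * E))"
      by (intro add_left_mono mult_left_mono S) simp
    also have "\<dots> = ennreal (LP_freq L 0) + ennreal (A + \<beta> * (C0 * LP_freq L 0 powr D * (M\<^sup>2 * E)))"
      using A l0_pos \<beta> C0 E0 by (simp add: ennreal_plus ennreal_mult add.assoc)
    also have "\<beta> * (C0 * LP_freq L 0 powr D * (M\<^sup>2 * E)) = A powr (- D) * (K * Y)"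
      by (simp add: \<beta>_def K_def Y_def power_mult_distrib)
    finally show ?thesis by (simp add: ennreal_minus_le_iff)
  qed
  then have "time_avg t T (\<lambda>\<tau>. determining_wavenumber chi L \<nu> r c (u \<tau>)) - ennreal (LP_freq L 0)
      \<le> ennreal (2 * (K * Y) powr (1 / (1 + D)))"
    by (rule ennreal_le_optimize_powr) (use K0 Y0 D in auto)
  \<comment> \<open>The exponent 1 / (1 + D) lies in (0,1], so the power of K is at most max 1 K;
    this removes d from the constant.\<close>
  also have "\<dots> \<le> ennreal (2 * (max 1 K * Y powr (1 / (1 + D))))"
  proof (intro ennreal_leI mult_left_mono)
    have "K powr (1 / (1 + D)) \<le> max 1 K powr (1 / (1 + D))"
      using K0 D by (intro powr_mono2) auto
    also have "\<dots> \<le> max 1 K powr 1"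
      using D by (intro powr_mono) auto
    finally show "(K * Y) powr (1 / (1 + D)) \<le> max 1 K * Y powr (1 / (1 + D))"
      unfolding powr_mult by (intro mult_right_mono) auto
  qed simp
  also have "Y powr (1 / (1 + D)) = kolmogorov_wavenumber L \<nu> d t T u powr ((1 + d) / (1 + D)) * LP_freq L 0 powr (- (2 * d) / (r + d * (r - 2)))"
    using dissipative_scaling[OF L \<nu> r(1) d(1) E0 D_def[THEN meta_eq_to_obj_eq]]
    unfolding kolmogorov_wavenumber_def dissipation_rate_def Y_def l0 E_def g_def by simp
  finally show ?thesis by (simp add: K_def mult_ac)
qed

theorem mainTheorem5:
  fixes chi :: "real^3 \<Rightarrow> real" and r c C0 :: real
  assumes "LP_cutoff chi" and "2 < r" and "r < 3" and "0 < c" and "0 < C0"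
  shows "\<exists>C>0. \<forall>(L::real) (\<nu>::real) (T::real) (f::(real^3 \<Rightarrow> real^3) \<Rightarrow> real)
           (u::real \<Rightarrow> real^3 \<Rightarrow> real^3) (a::real) (b::real) (t::real) (Q::real \<Rightarrow> enat) (d::real).
      0 < L \<and> 0 < \<nu> \<and> 0 < T \<and>
      f \<in> Hminus1_torus L \<and> zero_mean_force f \<and>
      leray_hopf_on L \<nu> f a b u \<and> a \<le> t \<and> t + T \<le> b \<and>
      (\<forall>\<tau>\<in>{t..t + T}. determining_wavenumber chi L \<nu> r c (u \<tau>) = LP_freq_enat L (Q \<tau>)) \<and>
      0 \<le> d \<and> d \<le> 3 \<and>
      intermittency chi L r C0 d t T Q u
      \<longrightarrow>
      (let excess = time_avg t T (\<lambda>\<tau>. determining_wavenumber chi L \<nu> r c (u \<tau>))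
                      - ennreal (LP_freq L 0);
           \<kappa> = kolmogorov_wavenumber L \<nu> d t T u;
           \<delta> = (6 - 2 * r) / (2 * r - 3)
       in excess \<le> ennreal (C * \<kappa> powr ((1 + d) / (1 + d * (1 - 2 / r)))
                              * LP_freq L 0 powr (- (2 * d) / (r + d * (r - 2)))) \<and>
          (d = 0 \<longrightarrow> excess \<le> ennreal (C * \<kappa>)) \<and>
          (d = 3 \<longrightarrow> excess \<le> ennreal (C * \<kappa> powr (2 + \<delta>) * LP_freq L 0 powr (-1 - \<delta>))))"
proof -
  obtain M where M: "\<And>\<xi>. chi \<xi> \<le> M" using LP_cutoff_bounded[OF assms(1)] by blast
  \<comment> \<open>\<open>M\<close> comes from the fixed cutoff alone, so \<open>C\<close> is
    settled before L, the viscosity, the solution and d are introduced.\<close>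
  define C where "C = 2 * max 1 (unresolved_const r * C0 * M\<^sup>2 / c\<^sup>2)"
  have C: "0 < C" by (simp add: C_def)
  show ?thesis
  proof (intro exI[of _ C] conjI C allI impI, elim conjE)
    fix L \<nu> T :: real and f u and a b t :: real and Q and d :: real
    assume L: "0 < L" and asm: "0 < \<nu>" "0 < T" "leray_hopf_on L \<nu> f a b u" "a \<le> t" "t + T \<le> b"
      "\<forall>\<tau>\<in>{t..t + T}. determining_wavenumber chi L \<nu> r c (u \<tau>) = LP_freq_enat L (Q \<tau>)"
      "0 \<le> d" "d \<le> 3" "intermittency chi L r C0 d t T Q u"
    define excess where "excess = time_avg t T (\<lambda>\<tau>. determining_wavenumber chi L \<nu> r c (u \<tau>)) - ennreal (LP_freq L 0)"
    define \<kappa> where "\<kappa> = kolmogorov_wavenumber L \<nu> d t T u"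
    define \<delta> where "\<delta> = (6 - 2 * r) / (2 * r - 3)"
    have main: "excess \<le> ennreal (C * \<kappa> powr ((1 + d) / (1 + d * (1 - 2 / r))) * LP_freq L 0 powr (- (2 * d) / (r + d * (r - 2))))"
      unfolding excess_def \<kappa>_def C_def
      using determining_wavenumber_average_le[OF assms(1) M assms(2-5) L asm(1-5) _ asm(7-9)] asm(6) by blast
    have \<kappa>: "0 \<le> \<kappa>" by (simp add: \<kappa>_def kolmogorov_wavenumber_def)
    have "excess \<le> ennreal (C * \<kappa>)" if "d = 0"
      using main that \<kappa> LP_freq_pos[OF L, of 0] by simp
    moreover have "excess \<le> ennreal (C * \<kappa> powr (2 + \<delta>) * LP_freq L 0 powr (-1 - \<delta>))" if "d = 3"
    proof -
      \<comment> \<open>At d = 3 the two sides of the first equation equal 2r / (2r - 3), those of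
        the second -3 / (2r - 3).\<close>
      have "(1 + d) / (1 + d * (1 - 2 / r)) = 2 + \<delta>" "- (2 * d) / (r + d * (r - 2)) = -1 - \<delta>"
        using assms(2,3) unfolding that \<delta>_def by (simp_all add: field_simps)
      with main show ?thesis by simp
    qed
    ultimately show "let excess = time_avg t T (\<lambda>\<tau>. determining_wavenumber chi L \<nu> r c (u \<tau>)) - ennreal (LP_freq L 0);
           \<kappa> = kolmogorov_wavenumber L \<nu> d t T u;
           \<delta> = (6 - 2 * r) / (2 * r - 3)
       in excess \<le> ennreal (C * \<kappa> powr ((1 + d) / (1 + d * (1 - 2 / r)))
                              * LP_freq L 0 powr (- (2 * d) / (r + d * (r - 2)))) \<and>
          (d = 0 \<longrightarrow> excess \<le> ennreal (C * \<kappa>)) \<and>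
          (d = 3 \<longrightarrow> excess \<le> ennreal (C * \<kappa> powr (2 + \<delta>) * LP_freq L 0 powr (-1 - \<delta>)))"
      using main unfolding Let_def excess_def \<kappa>_def \<delta>_def by blast
  qed
qed

end
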